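(* Let $F^{2n}=(M,M',F^{\ast})$ be a $2n$-dimensional pseudo-Finsler manifold, let $HM'$ be a non-linear connection on $M'$, let $\mathcal{U}'\subset M'$ be the domain of a chart with induced coordinates $(x^i,y^i)_{i=1}^{2n}$, and let $J_1,J_2,J_3$ be the almost hypercomplex structure on $\mathcal{U}'$ determined by $HM'$ and the chart (defined in the context). Suppose that $\nabla$ is a Finsler connection on $\mathcal{U}'$, i.e. a linear connection on the vertical bundle $V\mathcal{U}'$. Then the differential operator $D$ defined by $$D_XY=\tfrac12\{\nabla_XvY-J_1\nabla_XJ_1hY-J_2\nabla_XJ_2vY-J_3\nabla_XJ_3hY\},\qquad X,Y\in\Gamma(T\mathcal{U}'),$$ is a linear connection on $\mathcal{U}'$ (that is, on $T\mathcal{U}'$). Moreover $J_1$, $J_2$ and $J_3$ are parallel with respect to $D$; that is, $D_X(J_iY)=J_i(D_XY)$ for all $X,Y\in\Gamma(T\mathcal{U}')$ and $i=1,2,3$.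
   Context: Setting. $M$ is a smooth manifold of dimension $m=2n$ with tangent bundle projection $\pi:TM\to M$; $M'$ is a nonempty open submanifold of $TM$ with $\pi(M')=M$ and not meeting the zero section. Coordinates $(x^i,y^i)$, $i=1,\dots,2n$, on $\mathcal{U}'\subset M'$ are those induced on $TM$ by coordinates $(x^i)$ on $M$. A pseudo-Finsler manifold $(M,M',F^\ast)$ has a smooth function $F^\ast:M'\to\mathbb{R}$ that is positively homogeneous of degree two in $y$ ($F^\ast(x,ky)=k^2F^\ast(x,y)$ for $k>0$) and such that, at each point, the matrix $g_{ij}=\frac12\frac{\partial^2F^\ast}{\partial y^i\partial y^j}$ defines a quadratic form on $\mathbb{R}^m$ with $q$ negative and $m-q$ positive eigenvalues, $0<q<m$. The vertical bundle is $VM'=\ker(\pi_\ast:TM'\to TM)$. A non-linear connection is a distribution $HM'$ with $TM'=HM'\oplus VM'$; $h$ and $v$ denote the projections of $TM'$ onto $HM'$ and $VM'$. On $\mathcal{U}'$, $V\mathcal{U}'$ is spanned by $\partial_i=\frac{\partial}{\partial y^i}$ and $H\mathcal{U}'$ by $\delta_i=\frac{\partial}{\partial x^i}-N_i^j(x,y)\frac{\partial}{\partial y^j}$, where the functions $N_i^j$ are determined by $HM'$. A Finsler connection is a pair $(HM',\nabla)$ with $HM'$ a non-linear connection and $\nabla$ a linear connection on the vector bundle $VM'$ (on $\mathcal{U}'$: on $V\mathcal{U}'$), with derivatives $\nabla_X$ taken along arbitrary vector fields $X$. The almost hypercomplex structure on $\mathcal{U}'$ consists of the bundle endomorphisms $J_1,J_2,J_3$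 of $T\mathcal{U}'$ given, for $\alpha=1,\dots,n$, by $$J_1\delta_\alpha=\partial_\alpha,\quad J_1\delta_{n+\alpha}=-\partial_{n+\alpha},\quad J_1\partial_\alpha=-\delta_\alpha,\quad J_1\partial_{n+\alpha}=\delta_{n+\alpha},$$ $$J_2\delta_\alpha=\delta_{n+\alpha},\quad J_2\delta_{n+\alpha}=-\delta_\alpha,\quad J_2\partial_\alpha=\partial_{n+\alpha},\quad J_2\partial_{n+\alpha}=-\partial_\alpha,$$ $$J_3\delta_\alpha=-\partial_{n+\alpha},\quad J_3\delta_{n+\alpha}=-\partial_\alpha,\quad J_3\partial_\alpha=\delta_{n+\alpha},\quad J_3\partial_{n+\alpha}=\delta_\alpha.$$ In the formula for $D$, $J_1hY$, $J_3hY$ and $J_2vY$ are sections of $V\mathcal{U}'$, so all the $\nabla$-derivatives make sense. *)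

theory Defs
  imports
    "HOL-Analysis.Analysis"
    "HOL-Library.Function_Algebras"
    "HOL-Computational_Algebra.Polynomial"
begin

section \<open>Functions into a real vector space\<close>

instantiation "fun" :: (type, real_vector) real_vector
begin

definition scaleR_fun :: "real \<Rightarrow> ('a \<Rightarrow> 'b) \<Rightarrow> 'a \<Rightarrow> 'b"
  where "scaleR_fun r f = (\<lambda>x. r *\<^sub>R f x)"

instance
  by standard (auto simp: scaleR_fun_def fun_eq_iff algebra_simps)

end

section \<open>Smooth maps between Euclidean spaces\<close>

text \<open>Both predicates are only used for open \<open>S\<close>.\<close>

primrec C_on :: "nat \<Rightarrow> 'a::euclidean_space set \<Rightarrow> ('a \<Rightarrow> 'b::real_normed_vector) \<Rightarrow> bool" where
  "C_on 0 S f \<longleftrightarrow> continuous_on S f"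
| "C_on (Suc k) S f \<longleftrightarrow> (\<forall>x\<in>S. f differentiable (at x)) \<and>
     (\<forall>v. C_on k S (\<lambda>x. frechet_derivative f (at x) v))"

definition smooth_on :: "'a::euclidean_space set \<Rightarrow> ('a \<Rightarrow> 'b::real_normed_vector) \<Rightarrow> bool"
  where "smooth_on S f \<longleftrightarrow> (\<forall>k. C_on k S f)"

section \<open>Smooth manifolds\<close>

text \<open>
  A chart is a pair of its domain and its coordinate map; the values of the coordinate map
  outside the domain are irrelevant. A manifold is given by an atlas \<open>A\<close>, which need not be
  maximal; its set of points is the union of the chart domains and its topology is the one
  for which all charts are homeomorphisms onto open sets.
\<close>

type_synonym ('p, 'e) chart = "'p set \<times> ('p \<Rightarrow> 'e)"

definition chart_inv :: "('p, 'e) chart \<Rightarrow> 'e \<Rightarrow> 'p"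
  where "chart_inv c = inv_into (fst c) (snd c)"

definition points :: "('p, 'e) chart set \<Rightarrow> 'p set"
  where "points A = (\<Union>c\<in>A. fst c)"

definition smooth_atlas :: "('p, 'e::euclidean_space) chart set \<Rightarrow> bool" where
  "smooth_atlas A \<longleftrightarrow>
     (\<forall>c\<in>A. inj_on (snd c) (fst c) \<and> open (snd c ` fst c)) \<and>
     (\<forall>c\<in>A. \<forall>d\<in>A. open (snd c ` (fst c \<inter> fst d)) \<and>
        smooth_on (snd c ` (fst c \<inter> fst d)) (snd d \<circ> chart_inv c))"

definition manifold_topology :: "('p, 'e::euclidean_space) chart set \<Rightarrow> 'p topology" where
  "manifold_topology A =
     topology (\<lambda>W. W \<subseteq> points A \<and> (\<forall>c\<in>A. open (snd c ` (fst c \<inter> W))))"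

lemma openin_manifold_topology:
  assumes "\<And>c. c \<in> A \<Longrightarrow> inj_on (snd c) (fst c)"
  shows "openin (manifold_topology A) W \<longleftrightarrow>
           W \<subseteq> points A \<and> (\<forall>c\<in>A. open (snd c ` (fst c \<inter> W)))"
proof -
  have eq: "snd c ` (fst c \<inter> (S \<inter> T)) = snd c ` (fst c \<inter> S) \<inter> snd c ` (fst c \<inter> T)"
    if "c \<in> A" for c S T
    using assms[OF that] by (auto simp: inj_on_def)
  have un: "snd c ` (fst c \<inter> \<Union>K) = (\<Union>T\<in>K. snd c ` (fst c \<inter> T))" for c :: "('a, 'b) chart" and K
    by auto
  have "istopology (\<lambda>W. W \<subseteq> points A \<and> (\<forall>c\<in>A. open (snd c ` (fst c \<inter> W))))"
    unfolding istopology_def by (auto simp: eq un intro!: open_Int open_UN)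
  then show ?thesis
    unfolding manifold_topology_def by (simp add: topology_inverse')
qed

definition smooth_manifold :: "('p, 'e::euclidean_space) chart set \<Rightarrow> bool" where
  "smooth_manifold A \<longleftrightarrow> smooth_atlas A \<and>
     Hausdorff_space (manifold_topology A) \<and> second_countable (manifold_topology A)"

definition smooth_fun ::
    "('p, 'e::euclidean_space) chart set \<Rightarrow> 'p set \<Rightarrow> ('p \<Rightarrow> real) \<Rightarrow> bool" where
  "smooth_fun A W f \<longleftrightarrow> (\<forall>c\<in>A. smooth_on (snd c ` (fst c \<inter> W)) (f \<circ> chart_inv c))"

section \<open>Tangent vectors and vector fields\<close>

text \<open>
  A tangent vector at \<open>p\<close> is the family of its components in the charts around \<open>p\<close>, related by
  the derivatives of the transition maps (a contravariant vector). Components in charts not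
  containing \<open>p\<close> are set to 0, so that equality of tangent vectors at \<open>p\<close> is equality
  of functions.
\<close>

type_synonym ('p, 'e) tvec = "('p, 'e) chart \<Rightarrow> 'e"

definition tangent_space ::
    "('p, 'e::euclidean_space) chart set \<Rightarrow> 'p \<Rightarrow> ('p, 'e) tvec set" where
  "tangent_space A p = {w.
     (\<forall>c\<in>A. \<forall>d\<in>A. p \<in> fst c \<inter> fst d \<longrightarrow>
        w d = frechet_derivative (snd d \<circ> chart_inv c) (at (snd c p)) (w c)) \<and>
     (\<forall>c. \<not> (c \<in> A \<and> p \<in> fst c) \<longrightarrow> w c = 0)}"

text \<open>The tangent vector at \<open>p\<close> whose components in the chart \<open>c\<close> are \<open>e\<close>.\<close>

definition coord_vec ::
    "('p, 'e::euclidean_space) chart set \<Rightarrow> ('p, 'e) chart \<Rightarrow> 'p \<Rightarrow> 'e \<Rightarrow> ('p, 'e) tvec" where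
  "coord_vec A c p e = (\<lambda>d. if d \<in> A \<and> p \<in> fst d
     then frechet_derivative (snd d \<circ> chart_inv c) (at (snd c p)) e else 0)"

text \<open>
  The derivative of a vector-valued function \<open>f\<close> along \<open>w\<close>, a tangent vector at \<open>p\<close>; it does not
  depend on the chart used to compute it.
\<close>

definition deriv_along ::
    "('p, 'e::euclidean_space) chart set \<Rightarrow> 'p \<Rightarrow> ('p, 'e) tvec \<Rightarrow> ('p \<Rightarrow> 'b::real_normed_vector) \<Rightarrow> 'b"
  where
  "deriv_along A p w f =
     (let c = (SOME c. c \<in> A \<and> p \<in> fst c)
      in frechet_derivative (f \<circ> chart_inv c) (at (snd c p)) (w c))"

definition pushforward ::
    "('p, 'e::euclidean_space) chart set \<Rightarrow> ('q, 'f::euclidean_space) chart set \<Rightarrow> ('p \<Rightarrow> 'q) \<Rightarrow>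
     'p \<Rightarrow> ('p, 'e) tvec \<Rightarrow> ('q, 'f) tvec" where
  "pushforward A B f p w =
     (\<lambda>d. if d \<in> B \<and> f p \<in> fst d then deriv_along A p w (snd d \<circ> f) else 0)"

text \<open>
  Smooth vector fields on an open set \<open>W\<close>, extended by 0 outside \<open>W\<close>, so that equality of
  vector fields on \<open>W\<close> is equality of functions.
\<close>

definition vector_fields ::
    "('p, 'e::euclidean_space) chart set \<Rightarrow> 'p set \<Rightarrow> ('p \<Rightarrow> ('p, 'e) tvec) set" where
  "vector_fields A W = {X.
     (\<forall>p\<in>W. X p \<in> tangent_space A p) \<and> (\<forall>p. p \<notin> W \<longrightarrow> X p = 0) \<and>
     (\<forall>c\<in>A. smooth_on (snd c ` (fst c \<inter> W)) (\<lambda>x. X (chart_inv c x) c))}"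

text \<open>Smooth sections over \<open>W\<close> of the subbundle of the tangent bundle with fibres \<open>E p\<close>.\<close>

definition bundle_sections ::
    "('p, 'e::euclidean_space) chart set \<Rightarrow> 'p set \<Rightarrow> ('p \<Rightarrow> ('p, 'e) tvec set) \<Rightarrow>
     ('p \<Rightarrow> ('p, 'e) tvec) set" where
  "bundle_sections A W E = {X \<in> vector_fields A W. \<forall>p\<in>W. X p \<in> E p}"

definition apply_on :: "'p set \<Rightarrow> ('p \<Rightarrow> 'v \<Rightarrow> 'v::zero) \<Rightarrow> ('p \<Rightarrow> 'v) \<Rightarrow> 'p \<Rightarrow> 'v"
  where "apply_on W P X = (\<lambda>p. if p \<in> W then P p (X p) else 0)"

definition smooth_distribution ::
    "('p, 'e::euclidean_space) chart set \<Rightarrow> 'p set \<Rightarrow> nat \<Rightarrow> ('p \<Rightarrow> ('p, 'e) tvec set) \<Rightarrow> bool" where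
  "smooth_distribution A W k H \<longleftrightarrow>
     (\<forall>p\<in>W. subspace (H p) \<and> H p \<subseteq> tangent_space A p) \<and>
     (\<forall>p\<in>W. \<exists>U X. openin (manifold_topology A) U \<and> p \<in> U \<and> U \<subseteq> W \<and>
        (\<forall>i<k. X i \<in> vector_fields A U) \<and>
        (\<forall>q\<in>U. inj_on (\<lambda>i. X i q) {..<k} \<and> independent ((\<lambda>i. X i q) ` {..<k}) \<and>
               span ((\<lambda>i. X i q) ` {..<k}) = H q))"

text \<open>A linear connection over the open set \<open>W\<close> on the subbundle \<open>E\<close> of the tangent bundle.\<close>

definition linear_connection ::
    "('p, 'e::euclidean_space) chart set \<Rightarrow> 'p set \<Rightarrow> ('p \<Rightarrow> ('p, 'e) tvec set) \<Rightarrow>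
     (('p \<Rightarrow> ('p, 'e) tvec) \<Rightarrow> ('p \<Rightarrow> ('p, 'e) tvec) \<Rightarrow> ('p \<Rightarrow> ('p, 'e) tvec)) \<Rightarrow> bool" where
  "linear_connection A W E nab \<longleftrightarrow>
     (\<forall>X\<in>vector_fields A W. \<forall>Y\<in>bundle_sections A W E. nab X Y \<in> bundle_sections A W E) \<and>
     (\<forall>X\<in>vector_fields A W. \<forall>X'\<in>vector_fields A W. \<forall>Y\<in>bundle_sections A W E.
        nab (X + X') Y = nab X Y + nab X' Y) \<and>
     (\<forall>f. smooth_fun A W f \<longrightarrow> (\<forall>X\<in>vector_fields A W. \<forall>Y\<in>bundle_sections A W E.
        nab (\<lambda>p. f p *\<^sub>R X p) Y = (\<lambda>p. f p *\<^sub>R nab X Y p))) \<and>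
     (\<forall>X\<in>vector_fields A W. \<forall>Y\<in>bundle_sections A W E. \<forall>Y'\<in>bundle_sections A W E.
        nab X (Y + Y') = nab X Y + nab X Y') \<and>
     (\<forall>f. smooth_fun A W f \<longrightarrow> (\<forall>X\<in>vector_fields A W. \<forall>Y\<in>bundle_sections A W E.
        nab X (\<lambda>p. f p *\<^sub>R Y p) =
          (\<lambda>p. deriv_along A p (X p) f *\<^sub>R Y p + f p *\<^sub>R nab X Y p)))"

section \<open>The tangent bundle as a manifold\<close>

type_synonym ('p, 'e) tpoint = "'p \<times> ('p, 'e) tvec"

definition tangent_chart ::
    "('p, 'e::euclidean_space) chart set \<Rightarrow> ('p, 'e) chart \<Rightarrow> (('p, 'e) tpoint, 'e \<times> 'e) chart" where
  "tangent_chart A c =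
     ({(p, y). p \<in> fst c \<and> y \<in> tangent_space A p}, \<lambda>(p, y). (snd c p, y c))"

definition tangent_atlas ::
    "('p, 'e::euclidean_space) chart set \<Rightarrow> (('p, 'e) tpoint, 'e \<times> 'e) chart set" where
  "tangent_atlas A = tangent_chart A ` A"

definition vertical ::
    "('p, 'e::euclidean_space) chart set \<Rightarrow> ('p, 'e) tpoint \<Rightarrow>
     (('p, 'e) tpoint, 'e \<times> 'e) tvec set" where
  "vertical A u =
     {w \<in> tangent_space (tangent_atlas A) u. pushforward (tangent_atlas A) A fst u w = 0}"

definition nonlinear_connection ::
    "('p, 'e::euclidean_space) chart set \<Rightarrow> ('p, 'e) tpoint set \<Rightarrow>
     (('p, 'e) tpoint \<Rightarrow> (('p, 'e) tpoint, 'e \<times> 'e) tvec set) \<Rightarrow> bool" where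
  "nonlinear_connection A M' H \<longleftrightarrow>
     smooth_distribution (tangent_atlas A) M' DIM('e) H \<and>
     (\<forall>u\<in>M'. H u \<inter> vertical A u = {0} \<and>
        {a + b | a b. a \<in> H u \<and> b \<in> vertical A u} = tangent_space (tangent_atlas A) u)"

text \<open>The component of \<open>w\<close> in \<open>S\<close> with respect to the decomposition \<open>S \<oplus> T\<close>.\<close>

definition proj_along :: "'v::ab_group_add set \<Rightarrow> 'v set \<Rightarrow> 'v \<Rightarrow> 'v"
  where "proj_along S T w = (THE a. a \<in> S \<and> w - a \<in> T)"

definition hproj ::
    "('p, 'e::euclidean_space) chart set \<Rightarrow>
     (('p, 'e) tpoint \<Rightarrow> (('p, 'e) tpoint, 'e \<times> 'e) tvec set) \<Rightarrow>
     ('p, 'e) tpoint \<Rightarrow> (('p, 'e) tpoint, 'e \<times> 'e) tvec \<Rightarrow> (('p, 'e) tpoint, 'e \<times> 'e) tvec" where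
  "hproj A H u = proj_along (H u) (vertical A u)"

definition vproj ::
    "('p, 'e::euclidean_space) chart set \<Rightarrow>
     (('p, 'e) tpoint \<Rightarrow> (('p, 'e) tpoint, 'e \<times> 'e) tvec set) \<Rightarrow>
     ('p, 'e) tpoint \<Rightarrow> (('p, 'e) tpoint, 'e \<times> 'e) tvec \<Rightarrow> (('p, 'e) tpoint, 'e \<times> 'e) tvec" where
  "vproj A H u = proj_along (vertical A u) (H u)"

section \<open>Pseudo-Finsler manifolds\<close>

definition charpoly :: "real^'i^'i \<Rightarrow> real poly"
  where "charpoly G = det (\<chi> i j. (if i = j then [:0, 1:] else 0) - [:G $ i $ j:])"

text \<open>The number of eigenvalues in \<open>S\<close>, counted with multiplicity.\<close>

definition count_eigenvalues :: "real^'i^'i \<Rightarrow> real set \<Rightarrow> nat"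
  where "count_eigenvalues G S = (\<Sum>r | r \<in> S \<and> poly (charpoly G) r = 0. order r (charpoly G))"

text \<open>
  The matrix with entries \<open>1/2 \<partial>\<^sup>2F / \<partial>y\<^sup>i\<partial>y\<^sup>j\<close> at \<open>u\<close> in the coordinates induced by \<open>c\<close>.
\<close>

definition finsler_metric ::
    "('p, real^'i) chart set \<Rightarrow> (('p, real^'i) tpoint \<Rightarrow> real) \<Rightarrow> ('p, real^'i) chart \<Rightarrow>
     ('p, real^'i) tpoint \<Rightarrow> real^'i^'i" where
  "finsler_metric A F c u = (\<chi> i j. 1/2 *
     frechet_derivative
       (\<lambda>z. frechet_derivative (F \<circ> chart_inv (tangent_chart A c)) (at z) (0, axis j 1))
       (at (snd (tangent_chart A c) u)) (0, axis i 1))"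

definition pseudo_finsler_manifold ::
    "('p, real^'i) chart set \<Rightarrow> ('p, real^'i) tpoint set \<Rightarrow> (('p, real^'i) tpoint \<Rightarrow> real) \<Rightarrow>
     nat \<Rightarrow> bool" where
  "pseudo_finsler_manifold A M' F q \<longleftrightarrow>
     smooth_manifold A \<and>
     M' \<noteq> {} \<and> openin (manifold_topology (tangent_atlas A)) M' \<and>
     fst ` M' = points A \<and> (\<forall>(p, y)\<in>M'. y \<noteq> 0) \<and>
     smooth_fun (tangent_atlas A) M' F \<and>
     (\<forall>p y. \<forall>k>0. (p, y) \<in> M' \<and> (p, k *\<^sub>R y) \<in> M' \<longrightarrow> F (p, k *\<^sub>R y) = k\<^sup>2 * F (p, y)) \<and>
     0 < q \<and> q < CARD('i) \<and>
     (\<forall>u\<in>M'. \<forall>c\<in>A. fst u \<in> fst c \<longrightarrow>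
        count_eigenvalues (finsler_metric A F c u) {..<0} = q \<and>
        count_eigenvalues (finsler_metric A F c u) {0<..} = CARD('i) - q)"

section \<open>Adapted frames and the almost hypercomplex structure\<close>

definition ddx ::
    "('p, real^'i) chart set \<Rightarrow> ('p, real^'i) chart \<Rightarrow> ('p, real^'i) tpoint \<Rightarrow> 'i \<Rightarrow>
     (('p, real^'i) tpoint, (real^'i) \<times> (real^'i)) tvec" where
  "ddx A c u i = coord_vec (tangent_atlas A) (tangent_chart A c) u (axis i 1, 0)"

definition ddy ::
    "('p, real^'i) chart set \<Rightarrow> ('p, real^'i) chart \<Rightarrow> ('p, real^'i) tpoint \<Rightarrow> 'i \<Rightarrow>
     (('p, real^'i) tpoint, (real^'i) \<times> (real^'i)) tvec" where
  "ddy A c u i = coord_vec (tangent_atlas A) (tangent_chart A c) u (0, axis i 1)"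

definition conn_coeff ::
    "('p, real^'i) chart set \<Rightarrow>
     (('p, real^'i) tpoint \<Rightarrow> (('p, real^'i) tpoint, (real^'i) \<times> (real^'i)) tvec set) \<Rightarrow>
     ('p, real^'i) chart \<Rightarrow> ('p, real^'i) tpoint \<Rightarrow> 'i \<Rightarrow> 'i \<Rightarrow> real" where
  "conn_coeff A H c u =
     (THE N. \<forall>i. ddx A c u i - (\<Sum>j\<in>UNIV. N i j *\<^sub>R ddy A c u j) \<in> H u)"

definition delta ::
    "('p, real^'i) chart set \<Rightarrow>
     (('p, real^'i) tpoint \<Rightarrow> (('p, real^'i) tpoint, (real^'i) \<times> (real^'i)) tvec set) \<Rightarrow>
     ('p, real^'i) chart \<Rightarrow> ('p, real^'i) tpoint \<Rightarrow> 'i \<Rightarrow>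
     (('p, real^'i) tpoint, (real^'i) \<times> (real^'i)) tvec" where
  "delta A H c u i = ddx A c u i - (\<Sum>j\<in>UNIV. conn_coeff A H c u i j *\<^sub>R ddy A c u j)"

text \<open>The linear extension of \<open>b i \<mapsto> g i\<close>, for a linearly independent family \<open>b\<close>.\<close>

definition frame_map :: "('i::finite \<Rightarrow> 'v::real_vector) \<Rightarrow> ('i \<Rightarrow> 'v) \<Rightarrow> 'v \<Rightarrow> 'v"
  where "frame_map b g w = (\<Sum>i\<in>UNIV. representation (range b) w (b i) *\<^sub>R g i)"

definition adapted_frame ::
    "('p, real^'i) chart set \<Rightarrow>
     (('p, real^'i) tpoint \<Rightarrow> (('p, real^'i) tpoint, (real^'i) \<times> (real^'i)) tvec set) \<Rightarrow>
     ('p, real^'i) chart \<Rightarrow> ('p, real^'i) tpoint \<Rightarrow> 'i + 'i \<Rightarrow>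
     (('p, real^'i) tpoint, (real^'i) \<times> (real^'i)) tvec" where
  "adapted_frame A H c u = case_sum (delta A H c u) (ddy A c u)"

text \<open>
  From here on the coordinates are indexed by \<open>'n + 'n\<close>, with \<open>n = CARD('n)\<close>: the index \<open>\<alpha>\<close> is
  \<open>Inl \<alpha>\<close> and the index \<open>n + \<alpha>\<close> is \<open>Inr \<alpha>\<close>. In the adapted frame an outer \<open>Inl\<close> marks
  \<open>\<delta>\<^sub>i\<close> and an outer \<open>Inr\<close> marks \<open>\<partial>\<^sub>i\<close>.
\<close>

type_synonym ('p, 'n) tmpoint = "('p, real^('n + 'n)) tpoint"
type_synonym ('p, 'n) ttvec =
  "(('p, 'n) tmpoint, (real^('n + 'n)) \<times> (real^('n + 'n))) tvec"

definition J1 ::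
    "('p, real^('n::finite + 'n)) chart set \<Rightarrow> (('p, 'n) tmpoint \<Rightarrow> ('p, 'n) ttvec set) \<Rightarrow>
     ('p, real^('n + 'n)) chart \<Rightarrow> ('p, 'n) tmpoint \<Rightarrow> ('p, 'n) ttvec \<Rightarrow> ('p, 'n) ttvec" where
  "J1 A H c u = frame_map (adapted_frame A H c u) (\<lambda>k. case k of
       Inl (Inl \<alpha>) \<Rightarrow> ddy A c u (Inl \<alpha>)
     | Inl (Inr \<alpha>) \<Rightarrow> - ddy A c u (Inr \<alpha>)
     | Inr (Inl \<alpha>) \<Rightarrow> - delta A H c u (Inl \<alpha>)
     | Inr (Inr \<alpha>) \<Rightarrow> delta A H c u (Inr \<alpha>))"

definition J2 ::
    "('p, real^('n::finite + 'n)) chart set \<Rightarrow> (('p, 'n) tmpoint \<Rightarrow> ('p, 'n) ttvec set) \<Rightarrow>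
     ('p, real^('n + 'n)) chart \<Rightarrow> ('p, 'n) tmpoint \<Rightarrow> ('p, 'n) ttvec \<Rightarrow> ('p, 'n) ttvec" where
  "J2 A H c u = frame_map (adapted_frame A H c u) (\<lambda>k. case k of
       Inl (Inl \<alpha>) \<Rightarrow> delta A H c u (Inr \<alpha>)
     | Inl (Inr \<alpha>) \<Rightarrow> - delta A H c u (Inl \<alpha>)
     | Inr (Inl \<alpha>) \<Rightarrow> ddy A c u (Inr \<alpha>)
     | Inr (Inr \<alpha>) \<Rightarrow> - ddy A c u (Inl \<alpha>))"

definition J3 ::
    "('p, real^('n::finite + 'n)) chart set \<Rightarrow> (('p, 'n) tmpoint \<Rightarrow> ('p, 'n) ttvec set) \<Rightarrow>
     ('p, real^('n + 'n)) chart \<Rightarrow> ('p, 'n) tmpoint \<Rightarrow> ('p, 'n) ttvec \<Rightarrow> ('p, 'n) ttvec" where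
  "J3 A H c u = frame_map (adapted_frame A H c u) (\<lambda>k. case k of
       Inl (Inl \<alpha>) \<Rightarrow> - ddy A c u (Inr \<alpha>)
     | Inl (Inr \<alpha>) \<Rightarrow> - ddy A c u (Inl \<alpha>)
     | Inr (Inl \<alpha>) \<Rightarrow> delta A H c u (Inr \<alpha>)
     | Inr (Inr \<alpha>) \<Rightarrow> delta A H c u (Inl \<alpha>))"

definition induced_D ::
    "('p, real^('n::finite + 'n)) chart set \<Rightarrow> (('p, 'n) tmpoint \<Rightarrow> ('p, 'n) ttvec set) \<Rightarrow>
     ('p, real^('n + 'n)) chart \<Rightarrow> ('p, 'n) tmpoint set \<Rightarrow>
     ((('p, 'n) tmpoint \<Rightarrow> ('p, 'n) ttvec) \<Rightarrow> (('p, 'n) tmpoint \<Rightarrow> ('p, 'n) ttvec) \<Rightarrow>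
       (('p, 'n) tmpoint \<Rightarrow> ('p, 'n) ttvec)) \<Rightarrow>
     (('p, 'n) tmpoint \<Rightarrow> ('p, 'n) ttvec) \<Rightarrow> (('p, 'n) tmpoint \<Rightarrow> ('p, 'n) ttvec) \<Rightarrow>
       (('p, 'n) tmpoint \<Rightarrow> ('p, 'n) ttvec)" where
  "induced_D A H c U nab X Y =
     (let h = apply_on U (hproj A H); v = apply_on U (vproj A H);
          j1 = apply_on U (J1 A H c); j2 = apply_on U (J2 A H c); j3 = apply_on U (J3 A H c)
      in (1/2) *\<^sub>R (nab X (v Y) - j1 (nab X (j1 (h Y))) - j2 (nab X (j2 (v Y)))
                      - j3 (nab X (j3 (h Y)))))"

end

theory Submission
  imports Defs
begin

text \<open>
  In the adapted frame the maps \<open>h\<close>, \<open>v\<close>, \<open>J\<^sub>1\<close>, \<open>J\<^sub>2\<close>, \<open>J\<^sub>3\<close> have constant coefficients, and the frame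
  is smooth by Cramer's rule: horizontality of a local frame of \<open>H\<close> is a linear system for the \<open>N\<^sub>i\<^sub>j\<close>,
  invertible because \<open>H\<close> meets the vertical bundle in \<open>0\<close>. So these maps preserve smooth vector
  fields, and the rest is quaternion algebra. In the Leibniz rule the derivative terms sum to
  \<open>1/2 (vY - J\<^sub>1J\<^sub>1hY - J\<^sub>2J\<^sub>2vY - J\<^sub>3J\<^sub>3hY) = hY + vY = Y\<close>, and replacing \<open>Y\<close> by \<open>J\<^sub>iY\<close> permutes the four
  terms of \<open>D\<close> in the same way as applying \<open>J\<^sub>i\<close> does, since \<open>J\<^sub>2\<close> preserves the horizontal and vertical
  bundles while \<open>J\<^sub>1\<close> and \<open>J\<^sub>3\<close> exchange them.
\<close>

section \<open>Calculus of smooth maps\<close>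

text \<open>The formula for \<open>D\<close> is an average. The operator sending Y to
  \<open>nab X (v Y)\<close> acts on all vector fields, but satisfies the Leibniz rule only up to
  the projection v. Since J_a has inverse -J_a, conjugating this operator by 1, J_1, J_2, J_3
  produces exactly the four terms of \<open>D\<close>, once v has been moved past J_a. Signs cancel
  in a conjugation, so the sum over the four units is unchanged when conjugated by any J_i, which is
  parallelism. The factor is 1/2 and not 1/4 because the conjugates of v are v, h, v, h, with sum
  twice the identity. The longer part is smoothness. Fields must be smooth in every chart of the
  atlas, the coefficients N are given only by a definite description, and H is known only through
  local frames unrelated to the coordinates.\<close>

lemma frechet_derivative_cong_open:
  assumes "open S" "x \<in> S" "\<And>z. z \<in> S \<Longrightarrow> f z = g z"
  shows "frechet_derivative f (at x) = frechet_derivative g (at x)"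
proof -
  have "(f has_derivative F) (at x) \<longleftrightarrow> (g has_derivative F) (at x)" for F
    using has_derivative_transform_within_open[OF _ assms(1,2), where f = f and g = g]
      has_derivative_transform_within_open[OF _ assms(1,2), where f = g and g = f] assms(3)
    by auto
  then show ?thesis
    by (simp add: frechet_derivative_def)
qed

lemma differentiable_cong_open:
  assumes "open S" "x \<in> S" "\<And>z. z \<in> S \<Longrightarrow> f z = g z" "f differentiable (at x)"
  shows "g differentiable (at x)"
proof -
  obtain F where "(f has_derivative F) (at x)"
    using assms(4) by (auto simp: differentiable_def)
  from has_derivative_transform_within_open[OF this assms(1-3)] show ?thesis
    by (auto simp: differentiable_def)
qed

lemma C_on_cong:
  assumes "open S" "\<And>x. x \<in> S \<Longrightarrow> f x = g x" "C_on k S f"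
  shows "C_on k S g"
  using assms(2,3)
proof (induction k arbitrary: f g)
  case 0
  then show ?case by (metis C_on.simps(1) continuous_on_cong)
next
  case (Suc k)
  have "C_on k S (\<lambda>x. frechet_derivative g (at x) v)" for v
  proof (rule Suc.IH)
    show "C_on k S (\<lambda>x. frechet_derivative f (at x) v)"
      using Suc.prems by simp
  next
    fix x assume "x \<in> S"
    then show "frechet_derivative f (at x) v = frechet_derivative g (at x) v"
      using frechet_derivative_cong_open[OF assms(1), of x f g] Suc.prems by simp
  qed
  then show ?case
    using differentiable_cong_open[OF assms(1), of _ f g] Suc.prems by simp
qed

lemma C_on_subset:
  assumes "T \<subseteq> S" "C_on k S f"
  shows "C_on k T f"
  using assms by (induction k arbitrary: f) (auto intro: continuous_on_subset)

text \<open>A distribution comes with smooth frames only near each point, so what is computed from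
  them has to be glued.\<close>

lemma C_on_local:
  assumes "open S" "\<And>x. x \<in> S \<Longrightarrow> \<exists>T. open T \<and> x \<in> T \<and> C_on k T f"
  shows "C_on k S f"
  using assms(2)
proof (induction k arbitrary: f)
  case 0
  then have "continuous (at x) f" if "x \<in> S" for x
    using that by (metis C_on.simps(1) continuous_on_eq_continuous_at)
  then show ?case
    by (simp add: continuous_at_imp_continuous_on)
next
  case (Suc k)
  have "C_on k S (\<lambda>x. frechet_derivative f (at x) v)" for v
  proof (rule Suc.IH)
    fix x assume "x \<in> S"
    from Suc.prems[OF this] obtain T where "open T" "x \<in> T" "C_on (Suc k) T f" by blast
    then show "\<exists>T. open T \<and> x \<in> T \<and> C_on k T (\<lambda>x. frechet_derivative f (at x) v)"
      by auto
  qed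
  moreover have "f differentiable (at x)" if "x \<in> S" for x
    using Suc.prems[OF that] by auto
  ultimately show ?case by simp
qed

text \<open>\<open>frechet_derivative\<close> is a choice; by uniqueness of derivatives, any
  explicit derivative \<open>f'\<close> may replace it. Every closure rule below then only has to
  exhibit its derivative formula.\<close>

lemma C_on_SucI:
  assumes "open S" "\<And>x. x \<in> S \<Longrightarrow> (f has_derivative f' x) (at x)"
    and "\<And>v. C_on k S (\<lambda>x. f' x v)"
  shows "C_on (Suc k) S f"
proof -
  have "C_on k S (\<lambda>x. frechet_derivative f (at x) v)" for v
    by (rule C_on_cong[OF assms(1) _ assms(3)[of v]])
       (simp add: frechet_derivative_at[OF assms(2), symmetric])
  then show ?thesis
    using assms(2) by (auto simp: differentiable_def)
qed

lemma C_on_Suc_derivative: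
  assumes "C_on (Suc k) S f" "x \<in> S"
  shows "(f has_derivative frechet_derivative f (at x)) (at x)"
  using assms frechet_derivative_works by auto

lemma C_on_SucD:
  assumes "C_on (Suc k) S f"
  shows "C_on k S f"
  using assms
proof (induction k arbitrary: f)
  case 0
  then show ?case
    by (simp add: continuous_at_imp_continuous_on differentiable_imp_continuous_within)
next
  case (Suc k)
  have "C_on k S (\<lambda>x. frechet_derivative f (at x) v)" for v
    using Suc.IH Suc.prems by simp
  with Suc.prems show ?case by simp
qed

lemma C_on_const:
  assumes "open S"
  shows "C_on k S (\<lambda>x. a)"
proof (induction k arbitrary: a)
  case (Suc k)
  show ?case
    by (rule C_on_SucI[OF assms, where f' = "\<lambda>x v. 0"]) (auto intro: Suc)
qed auto

lemma C_on_add: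
  assumes "open S" "C_on k S f" "C_on k S g"
  shows "C_on k S (\<lambda>x. f x + g x)"
  using assms(2,3)
proof (induction k arbitrary: f g)
  case 0
  then show ?case by (auto intro: continuous_on_add)
next
  case (Suc k)
  show ?case
  proof (rule C_on_SucI[OF assms(1)])
    fix x assume "x \<in> S"
    then show "((\<lambda>x. f x + g x) has_derivative
        (\<lambda>v. frechet_derivative f (at x) v + frechet_derivative g (at x) v)) (at x)"
      by (intro has_derivative_add C_on_Suc_derivative[OF Suc.prems(1)]
          C_on_Suc_derivative[OF Suc.prems(2)])
  next
    show "C_on k S (\<lambda>x. frechet_derivative f (at x) v + frechet_derivative g (at x) v)" for v
      using Suc by simp
  qed
qed

lemma C_on_bilinear:
  assumes "bounded_bilinear b" "open S" "C_on k S f" "C_on k S g"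
  shows "C_on k S (\<lambda>x. b (f x) (g x))"
  using assms(3,4)
proof (induction k arbitrary: f g)
  case 0
  then show ?case by (simp add: bounded_bilinear.continuous_on[OF assms(1)])
next
  case (Suc k)
  show ?case
  proof (rule C_on_SucI[OF assms(2)])
    fix x assume "x \<in> S"
    then show "((\<lambda>x. b (f x) (g x)) has_derivative
        (\<lambda>v. b (f x) (frechet_derivative g (at x) v) + b (frechet_derivative f (at x) v) (g x))) (at x)"
      by (intro bounded_bilinear.FDERIV[OF assms(1)] C_on_Suc_derivative[OF Suc.prems(1)]
          C_on_Suc_derivative[OF Suc.prems(2)])
  next
    show "C_on k S (\<lambda>x. b (f x) (frechet_derivative g (at x) v) + b (frechet_derivative f (at x) v) (g x))" for v
      by (intro C_on_add[OF assms(2)] Suc.IH C_on_SucD[OF Suc.prems(1)] C_on_SucD[OF Suc.prems(2)])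
        (use Suc.prems in auto)
  qed
qed

lemma C_on_linear_compose:
  assumes "bounded_linear L" "open S" "C_on k S f"
  shows "C_on k S (\<lambda>x. L (f x))"
  using assms(3)
proof (induction k arbitrary: f)
  case 0
  then show ?case by (simp add: bounded_linear.continuous_on[OF assms(1)])
next
  case (Suc k)
  show ?case
  proof (rule C_on_SucI[OF assms(2)])
    fix x assume "x \<in> S"
    then show "((\<lambda>x. L (f x)) has_derivative (\<lambda>v. L (frechet_derivative f (at x) v))) (at x)"
      by (intro bounded_linear.has_derivative[OF assms(1)] C_on_Suc_derivative[OF Suc.prems])
  qed (use Suc in simp)
qed

lemma C_on_sum:
  assumes "open S" "\<And>i. i \<in> I \<Longrightarrow> C_on k S (f i)"
  shows "C_on k S (\<lambda>x. \<Sum>i\<in>I. f i x)"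
  using assms(2)
proof (induction I rule: infinite_finite_induct)
  case (insert i I)
  then show ?case by (simp add: C_on_add[OF assms(1)])
qed (auto intro: C_on_const[OF assms(1)])

lemma C_on_ident:
  assumes "open S"
  shows "C_on k S (\<lambda>x. x)"
proof (cases k)
  case (Suc l)
  show ?thesis unfolding Suc
    by (rule C_on_SucI[OF assms, where f' = "\<lambda>x v. v"]) (auto intro: C_on_const assms)
qed auto

text \<open>\<open>C_on\<close> controls derivatives in fixed directions only. Where the direction
  itself varies with the point, as in the chain rule, this expansion brings the derivative back to
  the fixed basis directions.\<close>

lemma linear_euclidean_expansion:
  assumes "linear F"
  shows "F v = (\<Sum>b\<in>Basis. (v \<bullet> b) *\<^sub>R F b)"
proof -
  have "F v = F (\<Sum>b\<in>Basis. (v \<bullet> b) *\<^sub>R b)" by (simp add: euclidean_representation)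
  also have "\<dots> = (\<Sum>b\<in>Basis. (v \<bullet> b) *\<^sub>R F b)"
    by (simp add: linear_sum[OF assms] linear_cmul[OF assms])
  finally show ?thesis .
qed

lemma C_on_compose:
  assumes "open S" "open T" "f ` S \<subseteq> T" "C_on k S f" "C_on k T g"
  shows "C_on k S (\<lambda>x. g (f x))"
  using assms(4,5)
proof (induction k arbitrary: g)
  case 0
  then show ?case using continuous_on_compose2 assms(3) by auto
next
  case (Suc k)
  show ?case
  proof (rule C_on_SucI[OF assms(1)])
    fix x assume "x \<in> S"
    have fd: "(f has_derivative frechet_derivative f (at x)) (at x)"
      by (rule C_on_Suc_derivative[OF Suc.prems(1) \<open>x \<in> S\<close>])
    have gd: "(g has_derivative frechet_derivative g (at (f x))) (at (f x))"
      by (rule C_on_Suc_derivative[OF Suc.prems(2)]) (use \<open>x \<in> S\<close> assms(3) in blast)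
    have "((\<lambda>x. g (f x)) has_derivative
        (\<lambda>v. frechet_derivative g (at (f x)) (frechet_derivative f (at x) v))) (at x)"
      using diff_chain_at[OF fd gd] by (simp add: o_def)
    moreover have "frechet_derivative g (at (f x)) (frechet_derivative f (at x) v) =
        (\<Sum>b\<in>Basis. (frechet_derivative f (at x) v \<bullet> b) *\<^sub>R frechet_derivative g (at (f x)) b)" for v
      by (rule linear_euclidean_expansion) (use gd has_derivative_linear in blast)
    ultimately show "((\<lambda>x. g (f x)) has_derivative
        (\<lambda>v. \<Sum>b\<in>Basis. (frechet_derivative f (at x) v \<bullet> b) *\<^sub>R frechet_derivative g (at (f x)) b)) (at x)"
      by simp
  next
    fix v
    have "C_on k S (\<lambda>x. frechet_derivative f (at x) v \<bullet> b)" for b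
      using Suc.prems
      by (intro C_on_linear_compose[OF bounded_linear_inner_left assms(1)]) simp
    moreover have "C_on k S (\<lambda>x. frechet_derivative g (at (f x)) b)" for b
      using Suc.prems by (intro Suc.IH) (auto intro: C_on_SucD)
    ultimately show "C_on k S (\<lambda>x. \<Sum>b\<in>Basis. (frechet_derivative f (at x) v \<bullet> b) *\<^sub>R frechet_derivative g (at (f x)) b)"
      by (intro C_on_sum C_on_bilinear[OF bounded_bilinear_scaleR] assms)
  qed
qed

lemma C_on_inverse:
  fixes f :: "'a::euclidean_space \<Rightarrow> real"
  assumes "open S" "\<And>x. x \<in> S \<Longrightarrow> f x \<noteq> 0" "C_on k S f"
  shows "C_on k S (\<lambda>x. inverse (f x))"
  using assms(3)
proof (induction k)
  case 0
  then show ?case using assms(2) by (auto intro!: continuous_on_inverse)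
next
  case (Suc k)
  have mult: "C_on k S (\<lambda>x. g x * h x)" if "C_on k S g" "C_on k S h" for g h :: "'a \<Rightarrow> real"
    by (rule C_on_bilinear[OF bounded_bilinear_mult assms(1) that])
  show ?case
  proof (rule C_on_SucI[OF assms(1)])
    fix x assume "x \<in> S"
    then show "((\<lambda>x. inverse (f x)) has_derivative
       (\<lambda>v. - (inverse (f x) * frechet_derivative f (at x) v * inverse (f x)))) (at x)"
      by (intro Deriv.has_derivative_inverse C_on_Suc_derivative[OF Suc.prems] assms(2))
  next
    fix v
    have "C_on k S (\<lambda>x. (- 1) * (inverse (f x) * frechet_derivative f (at x) v * inverse (f x)))"
      by (intro mult C_on_const[OF assms(1)] Suc.IH C_on_SucD[OF Suc.prems])
        (use Suc.prems in simp)
    then show "C_on k S (\<lambda>x. - (inverse (f x) * frechet_derivative f (at x) v * inverse (f x)))"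
      by simp
  qed
qed

section \<open>Closure properties of smooth maps, up to the solution of linear systems\<close>

lemma smooth_on_cong:
  "open S \<Longrightarrow> (\<And>x. x \<in> S \<Longrightarrow> f x = g x) \<Longrightarrow> smooth_on S f \<Longrightarrow> smooth_on S g"
  using C_on_cong[of S f g] by (auto simp: smooth_on_def)

lemma smooth_on_subset: "T \<subseteq> S \<Longrightarrow> smooth_on S f \<Longrightarrow> smooth_on T f"
  unfolding smooth_on_def using C_on_subset by blast

lemma smooth_on_local:
  assumes "open S" "\<And>x. x \<in> S \<Longrightarrow> \<exists>T. open T \<and> x \<in> T \<and> smooth_on T f"
  shows "smooth_on S f"
  unfolding smooth_on_def
proof
  show "C_on k S f" for k
    by (rule C_on_local[OF assms(1)]) (use assms(2) in \<open>auto simp: smooth_on_def\<close>)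
qed

lemma smooth_on_differentiable: "smooth_on S f \<Longrightarrow> x \<in> S \<Longrightarrow> f differentiable (at x)"
  unfolding smooth_on_def by (drule spec[of _ "Suc 0"]) simp

lemma smooth_on_has_derivative:
  "smooth_on S f \<Longrightarrow> x \<in> S \<Longrightarrow> (f has_derivative frechet_derivative f (at x)) (at x)"
  by (simp add: smooth_on_differentiable frechet_derivative_works[symmetric])

lemma smooth_on_derivative: "smooth_on S f \<Longrightarrow> smooth_on S (\<lambda>x. frechet_derivative f (at x) v)"
  unfolding smooth_on_def
proof
  fix k assume "\<forall>k. C_on k S f"
  then have "C_on (Suc k) S f" ..
  then show "C_on k S (\<lambda>x. frechet_derivative f (at x) v)" by simp
qed

lemma smooth_on_const: "open S \<Longrightarrow> smooth_on S (\<lambda>x. a)"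
  unfolding smooth_on_def using C_on_const by blast

lemma smooth_on_ident: "open S \<Longrightarrow> smooth_on S (\<lambda>x. x)"
  unfolding smooth_on_def using C_on_ident by blast

lemma smooth_on_add: "open S \<Longrightarrow> smooth_on S f \<Longrightarrow> smooth_on S g \<Longrightarrow> smooth_on S (\<lambda>x. f x + g x)"
  by (simp add: smooth_on_def C_on_add)

lemma smooth_on_sum:
  "open S \<Longrightarrow> (\<And>i. i \<in> I \<Longrightarrow> smooth_on S (f i)) \<Longrightarrow> smooth_on S (\<lambda>x. \<Sum>i\<in>I. f i x)"
  by (simp add: smooth_on_def C_on_sum)

lemma smooth_on_bilinear:
  "bounded_bilinear b \<Longrightarrow> open S \<Longrightarrow> smooth_on S f \<Longrightarrow> smooth_on S g \<Longrightarrow>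
     smooth_on S (\<lambda>x. b (f x) (g x))"
  by (simp add: smooth_on_def C_on_bilinear)

lemmas smooth_on_scaleR = smooth_on_bilinear[OF bounded_bilinear_scaleR]
lemmas smooth_on_mult = smooth_on_bilinear[OF bounded_bilinear_mult]

lemma smooth_on_linear_compose:
  "bounded_linear L \<Longrightarrow> open S \<Longrightarrow> smooth_on S f \<Longrightarrow> smooth_on S (\<lambda>x. L (f x))"
  by (simp add: smooth_on_def C_on_linear_compose)

lemmas smooth_on_inner_left = smooth_on_linear_compose[OF bounded_linear_inner_left]
lemmas smooth_on_fst = smooth_on_linear_compose[OF bounded_linear_fst]
lemmas smooth_on_snd = smooth_on_linear_compose[OF bounded_linear_snd]
lemmas smooth_on_vec_nth = smooth_on_linear_compose[OF bounded_linear_vec_nth]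

lemma smooth_on_minus:
  fixes f :: "'a::euclidean_space \<Rightarrow> 'b::real_normed_vector"
  shows "open S \<Longrightarrow> smooth_on S f \<Longrightarrow> smooth_on S (\<lambda>x. - f x)"
  by (rule smooth_on_linear_compose) (auto intro: bounded_linear_minus bounded_linear_ident)

lemma smooth_on_compose:
  "open S \<Longrightarrow> open T \<Longrightarrow> f ` S \<subseteq> T \<Longrightarrow> smooth_on S f \<Longrightarrow> smooth_on T g \<Longrightarrow>
     smooth_on S (\<lambda>x. g (f x))"
  by (simp add: smooth_on_def C_on_compose)

lemma smooth_on_inverse:
  fixes f :: "'a::euclidean_space \<Rightarrow> real"
  shows "open S \<Longrightarrow> (\<And>x. x \<in> S \<Longrightarrow> f x \<noteq> 0) \<Longrightarrow> smooth_on S f \<Longrightarrow> smooth_on S (\<lambda>x. inverse (f x))"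
  by (simp add: smooth_on_def C_on_inverse)

lemma smooth_on_prod:
  fixes f :: "'i \<Rightarrow> 'a::euclidean_space \<Rightarrow> real"
  assumes "open S" "\<And>i. i \<in> I \<Longrightarrow> smooth_on S (f i)"
  shows "smooth_on S (\<lambda>x. \<Prod>i\<in>I. f i x)"
  using assms(2)
proof (induction I rule: infinite_finite_induct)
  case (insert i I)
  then show ?case by (simp add: smooth_on_mult[OF assms(1)])
qed (auto intro: smooth_on_const[OF assms(1)])

lemma smooth_on_Pair:
  assumes "open S" "smooth_on S f" "smooth_on S g"
  shows "smooth_on S (\<lambda>x. (f x, g x))"
proof -
  have "smooth_on S (\<lambda>x. (f x, 0) + (0, g x))"
    using assms
    by (intro smooth_on_add smooth_on_linear_compose[where L = "\<lambda>y. (y, 0)"]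
        smooth_on_linear_compose[where L = "\<lambda>y. (0, y)"] bounded_linear_Pair
        bounded_linear_ident bounded_linear_zero)
  then show ?thesis by simp
qed

lemma smooth_on_det:
  fixes G :: "'a::euclidean_space \<Rightarrow> real^'i^'i"
  assumes "open S" "\<And>i j. smooth_on S (\<lambda>x. G x $ i $ j)"
  shows "smooth_on S (\<lambda>x. det (G x))"
  unfolding det_def
  by (intro smooth_on_sum smooth_on_mult smooth_on_prod smooth_on_const assms)

text \<open>Cramer's rule writes \<open>y x $ k\<close> as a quotient of determinants, which are
  polynomials in the entries of \<open>G x\<close> and \<open>b x\<close>. So regularity of the
  solution is a conclusion, although \<open>y\<close> may be specified in a non-constructive
  way.\<close>

lemma smooth_on_solve:
  fixes G :: "'a::euclidean_space \<Rightarrow> real^'i^'i" and b y :: "'a \<Rightarrow> real^'i"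
  assumes S: "open S" and G: "\<And>i j. smooth_on S (\<lambda>x. G x $ i $ j)"
    and b: "\<And>i. smooth_on S (\<lambda>x. b x $ i)"
    and nz: "\<And>x. x \<in> S \<Longrightarrow> det (G x) \<noteq> 0"
    and eq: "\<And>x. x \<in> S \<Longrightarrow> G x *v y x = b x"
  shows "smooth_on S (\<lambda>x. y x $ k)"
proof (rule smooth_on_cong[OF S])
  show "smooth_on S (\<lambda>x. det (\<chi> i j. if j = k then b x $ i else G x $ i $ j) * inverse (det (G x)))"
  proof (intro smooth_on_mult smooth_on_inverse smooth_on_det S G nz)
    fix i j
    show "smooth_on S (\<lambda>x. (\<chi> i j. if j = k then b x $ i else G x $ i $ j) $ i $ j)"
      using G b by (cases "j = k") simp_all
  qed
  show "det (\<chi> i j. if j = k then b x $ i else G x $ i $ j) * inverse (det (G x)) = y x $ k"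
    if "x \<in> S" for x
    using cramer[OF nz[OF that], of "y x" "b x"] eq[OF that] by (simp add: divide_inverse)
qed

section \<open>Smooth atlases and tangent vectors\<close>

abbreviation transition ::
    "('p, 'e::euclidean_space) chart \<Rightarrow> ('p, 'e) chart \<Rightarrow> 'e \<Rightarrow> 'e"
  where "transition c d \<equiv> snd d \<circ> chart_inv c"

abbreviation transition_derivative ::
    "('p, 'e::euclidean_space) chart \<Rightarrow> ('p, 'e) chart \<Rightarrow> 'p \<Rightarrow> 'e \<Rightarrow> 'e"
  where "transition_derivative c d p \<equiv> frechet_derivative (transition c d) (at (snd c p))"

context
  fixes A :: "('p, 'e::euclidean_space) chart set"
  assumes A: "smooth_atlas A"
begin

lemma chart_inj: "c \<in> A \<Longrightarrow> inj_on (snd c) (fst c)"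
  using A by (auto simp: smooth_atlas_def)

lemma chart_inv_snd [simp]: "c \<in> A \<Longrightarrow> p \<in> fst c \<Longrightarrow> chart_inv c (snd c p) = p"
  by (simp add: chart_inv_def chart_inj)

lemma open_overlap: "c \<in> A \<Longrightarrow> d \<in> A \<Longrightarrow> open (snd c ` (fst c \<inter> fst d))"
  using A by (auto simp: smooth_atlas_def)

lemma open_chart_image: "c \<in> A \<Longrightarrow> open (snd c ` fst c)"
  using A by (auto simp: smooth_atlas_def)

lemma smooth_transition:
  "c \<in> A \<Longrightarrow> d \<in> A \<Longrightarrow> smooth_on (snd c ` (fst c \<inter> fst d)) (transition c d)"
  using A by (auto simp: smooth_atlas_def)

lemma transition_has_derivative:
  assumes "c \<in> A" "d \<in> A" "p \<in> fst c" "p \<in> fst d"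
  shows "(transition c d has_derivative transition_derivative c d p) (at (snd c p))"
  by (rule smooth_on_has_derivative[OF smooth_transition[OF assms(1,2)]]) (use assms in auto)

lemma linear_transition_derivative:
  "c \<in> A \<Longrightarrow> d \<in> A \<Longrightarrow> p \<in> fst c \<Longrightarrow> p \<in> fst d \<Longrightarrow> linear (transition_derivative c d p)"
  using transition_has_derivative has_derivative_linear by blast

text \<open>Chain rule: the composite of two transition maps agrees with the direct one on an open
  neighbourhood of the point. This cocycle identity is what makes \<open>coord_vec\<close> a tangent
  vector.\<close>

lemma transition_derivative_trans:
  assumes "c \<in> A" "d \<in> A" "e \<in> A" "p \<in> fst c" "p \<in> fst d" "p \<in> fst e"
  shows "transition_derivative d e p (transition_derivative c d p v) = transition_derivative c e p v"
proof -
  have p: "transition c d (snd c p) = snd d p"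
    using assms by simp
  have de: "(transition d e has_derivative transition_derivative d e p) (at (transition c d (snd c p)))"
    unfolding p using transition_has_derivative assms by blast
  have "((transition d e \<circ> transition c d) has_derivative
          transition_derivative d e p \<circ> transition_derivative c d p) (at (snd c p))"
    by (rule diff_chain_at[OF transition_has_derivative de]) (use assms in auto)
  then have "(transition c e has_derivative
          transition_derivative d e p \<circ> transition_derivative c d p) (at (snd c p))"
    by (rule has_derivative_transform_within_open[OF _ open_overlap[OF assms(1,2)]])
       (use assms in auto)
  from has_derivative_unique[OF transition_has_derivative this] show ?thesis
    using assms by (metis comp_apply)
qed

lemma transition_derivative_refl:
  assumes "c \<in> A" "p \<in> fst c"
  shows "transition_derivative c c p v = v"
proof -
  have "((\<lambda>x. x) has_derivative (\<lambda>v. v)) (at (snd c p))"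
    by simp
  then have "(transition c c has_derivative (\<lambda>v. v)) (at (snd c p))"
    by (rule has_derivative_transform_within_open[OF _ open_chart_image[OF assms(1)]])
       (use assms in auto)
  from has_derivative_unique[OF transition_has_derivative this] show ?thesis
    using assms by metis
qed

lemma coord_vec_self: "c \<in> A \<Longrightarrow> p \<in> fst c \<Longrightarrow> coord_vec A c p e c = e"
  by (simp add: coord_vec_def transition_derivative_refl)

lemma linear_coord_vec:
  assumes "c \<in> A" "p \<in> fst c"
  shows "linear (coord_vec A c p)"
  using linear_transition_derivative[OF assms(1) _ assms(2)]
  by (intro linearI ext) (simp_all add: coord_vec_def scaleR_fun_def linear_add linear_cmul)

lemma coord_vec_in_tangent_space:
  assumes "c \<in> A" "p \<in> fst c"
  shows "coord_vec A c p e \<in> tangent_space A p"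
  using assms transition_derivative_trans[OF assms(1) _ _ assms(2)]
  by (auto simp: tangent_space_def coord_vec_def)

text \<open>Together with \<open>coord_vec_self\<close> this identifies the tangent space with the
  model space through one chart, so that equations between tangent vectors may be checked in a
  single component.\<close>

lemma coord_vec_component:
  assumes "c \<in> A" "p \<in> fst c" "w \<in> tangent_space A p"
  shows "coord_vec A c p (w c) = w"
proof
  have "w d = transition_derivative c d p (w c)" if "d \<in> A" "p \<in> fst d" for d
    using assms that unfolding tangent_space_def by blast
  moreover have "w d = 0" if "\<not> (d \<in> A \<and> p \<in> fst d)" for d
    using assms that unfolding tangent_space_def by blast
  ultimately show "coord_vec A c p (w c) d = w d" for d
    unfolding coord_vec_def by metis
qed

lemma tangent_space_eqI:
  assumes "c \<in> A" "p \<in> fst c" "w \<in> tangent_space A p" "w' \<in> tangent_space A p" "w c = w' c"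
  shows "w = w'"
  by (subst coord_vec_component[OF assms(1-3), symmetric])
     (simp only: assms(5) coord_vec_component[OF assms(1,2,4)])

lemma tangent_space_component:
  assumes "c \<in> A" "d \<in> A" "p \<in> fst c" "p \<in> fst d" "w \<in> tangent_space A p"
  shows "w d = transition_derivative c d p (w c)"
  using assms unfolding tangent_space_def by blast

lemma tangent_spaceI:
  assumes "\<And>c d. c \<in> A \<Longrightarrow> d \<in> A \<Longrightarrow> p \<in> fst c \<Longrightarrow> p \<in> fst d \<Longrightarrow> w d = transition_derivative c d p (w c)"
    and "\<And>c. \<not> (c \<in> A \<and> p \<in> fst c) \<Longrightarrow> w c = 0"
  shows "w \<in> tangent_space A p"
  using assms unfolding tangent_space_def by blast

lemma tangent_space_outside:
  "w \<in> tangent_space A p \<Longrightarrow> \<not> (c \<in> A \<and> p \<in> fst c) \<Longrightarrow> w c = 0"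
  unfolding tangent_space_def by blast

lemma subspace_tangent_space: "subspace (tangent_space A p)"
proof (rule subspaceI)
  show "0 \<in> tangent_space A p"
    by (rule tangent_spaceI) (simp_all add: linear_0[OF linear_transition_derivative])
next
  fix x y assume x: "x \<in> tangent_space A p" and y: "y \<in> tangent_space A p"
  show "x + y \<in> tangent_space A p"
  proof (rule tangent_spaceI)
    fix c d assume cd: "c \<in> A" "d \<in> A" "p \<in> fst c" "p \<in> fst d"
    show "(x + y) d = transition_derivative c d p ((x + y) c)"
      by (simp add: linear_add[OF linear_transition_derivative[OF cd]]
          tangent_space_component[OF cd x] tangent_space_component[OF cd y])
  qed (simp add: tangent_space_outside[OF x] tangent_space_outside[OF y])
next
  fix r x assume x: "x \<in> tangent_space A p"
  show "r *\<^sub>R x \<in> tangent_space A p"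
  proof (rule tangent_spaceI)
    fix c d assume cd: "c \<in> A" "d \<in> A" "p \<in> fst c" "p \<in> fst d"
    show "(r *\<^sub>R x) d = transition_derivative c d p ((r *\<^sub>R x) c)"
      by (simp add: scaleR_fun_def linear_cmul[OF linear_transition_derivative[OF cd]]
          tangent_space_component[OF cd x])
  qed (simp add: scaleR_fun_def tangent_space_outside[OF x])
qed

section \<open>Vector fields tested in a single chart\<close>

lemma open_image_openin:
  "openin (manifold_topology A) W \<Longrightarrow> c \<in> A \<Longrightarrow> open (snd c ` (fst c \<inter> W))"
  by (simp add: openin_manifold_topology chart_inj)

text \<open>The component in another chart \<open>d\<close> is the derivative of the transition map
  applied to the component in \<open>c\<close>. Expanded over the basis, this is a sum of products
  of smooth functions, composed with the inverse transition.\<close>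

lemma vector_fields_iff_chart:
  assumes c: "c \<in> A" and W: "openin (manifold_topology A) W" "W \<subseteq> fst c"
  shows "X \<in> vector_fields A W \<longleftrightarrow>
     (\<forall>p\<in>W. X p \<in> tangent_space A p) \<and> (\<forall>p. p \<notin> W \<longrightarrow> X p = 0) \<and>
     smooth_on (snd c ` W) (\<lambda>x. X (chart_inv c x) c)" (is "_ \<longleftrightarrow> ?R")
proof
  have cW: "fst c \<inter> W = W" using W by auto
  show "X \<in> vector_fields A W \<Longrightarrow> ?R"
    using c cW unfolding vector_fields_def by fastforce
  assume R: ?R
  have "smooth_on (snd d ` (fst d \<inter> W)) (\<lambda>x. X (chart_inv d x) d)" if d: "d \<in> A" for d
  proof -
    let ?S = "snd d ` (fst d \<inter> W)" and ?T = "snd c ` (W \<inter> fst d)"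
    let ?K = "\<lambda>y. \<Sum>b\<in>Basis. (X (chart_inv c y) c \<bullet> b) *\<^sub>R frechet_derivative (transition c d) (at y) b"
    have S: "open ?S"
      using open_image_openin[OF W(1) d] .
    \<comment> \<open>Injectivity of the chart turns the image of the intersection into an
      intersection of two images already known to be open.\<close>
    have T_eq: "?T = snd c ` (fst c \<inter> W) \<inter> snd c ` (fst c \<inter> fst d)"
      using chart_inj[OF c] W(2) by (auto simp: inj_on_def)
    have T: "open ?T"
      unfolding T_eq using open_image_openin[OF W(1) c] open_overlap[OF c d] by blast
    have "smooth_on ?T ?K"
    proof (intro smooth_on_sum smooth_on_scaleR smooth_on_inner_left smooth_on_derivative T)
      show "smooth_on ?T (\<lambda>y. X (chart_inv c y) c)"
        by (rule smooth_on_subset[of _ "snd c ` W"]) (use R in auto)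
      show "smooth_on ?T (transition c d)"
        by (rule smooth_on_subset[OF _ smooth_transition[OF c d]]) (use W in auto)
    qed
    then have "smooth_on ?S (\<lambda>x. ?K (transition d c x))"
    proof (rule smooth_on_compose[OF S T, rotated 2])
      show "transition d c ` ?S \<subseteq> ?T"
        using d by auto
      show "smooth_on ?S (transition d c)"
        by (rule smooth_on_subset[OF _ smooth_transition[OF d c]]) (use W in auto)
    qed
    then show ?thesis
    proof (rule smooth_on_cong[OF S, rotated])
      fix x assume "x \<in> ?S"
      then obtain p where p: "p \<in> fst d" "p \<in> W" "x = snd d p" by auto
      then have pc: "p \<in> fst c" using W by auto
      have "?K (transition d c x) = transition_derivative c d p (X p c)"
        using linear_euclidean_expansion[OF linear_transition_derivative[OF c d pc p(1)], of "X p c"]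
        by (simp add: p c d pc)
      also have "\<dots> = X (chart_inv d x) d"
        using tangent_space_component[OF c d pc p(1)] R p d by simp
      finally show "?K (transition d c x) = X (chart_inv d x) d" .
    qed
  qed
  then show "X \<in> vector_fields A W"
    using R by (simp add: vector_fields_def)
qed

section \<open>The atlas of the tangent bundle\<close>

lemma fst_tangent_chart: "u \<in> fst (tangent_chart A c) \<longleftrightarrow> fst u \<in> fst c \<and> snd u \<in> tangent_space A (fst u)"
  by (cases u) (simp add: tangent_chart_def)

lemma snd_tangent_chart: "snd (tangent_chart A c) u = (snd c (fst u), snd u c)"
  by (cases u) (simp add: tangent_chart_def)

text \<open>Every fibre coordinate is attained, by a \<open>coord_vec\<close>, so chart images are
  full cylinders and their openness reduces to openness in the base.\<close>

lemma image_tangent_chart: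
  assumes "c \<in> A" "S \<subseteq> fst c"
  shows "snd (tangent_chart A c) ` {u. fst u \<in> S \<and> snd u \<in> tangent_space A (fst u)} = (snd c ` S) \<times> UNIV"
proof
  show "(snd c ` S) \<times> UNIV \<subseteq> snd (tangent_chart A c) ` {u. fst u \<in> S \<and> snd u \<in> tangent_space A (fst u)}"
  proof (clarify)
    fix p y assume p: "p \<in> S"
    then have "p \<in> fst c" using assms by auto
    then show "(snd c p, y) \<in> snd (tangent_chart A c) ` {u. fst u \<in> S \<and> snd u \<in> tangent_space A (fst u)}"
      using p assms
      by (intro image_eqI[of _ _ "(p, coord_vec A c p y)"])
         (auto simp: snd_tangent_chart coord_vec_self coord_vec_in_tangent_space)
  qed
qed (auto simp: snd_tangent_chart)

lemma inj_on_tangent_chart: "c \<in> A \<Longrightarrow> inj_on (snd (tangent_chart A c)) (fst (tangent_chart A c))"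
proof (rule inj_onI)
  fix u u' assume c: "c \<in> A" and u: "u \<in> fst (tangent_chart A c)" "u' \<in> fst (tangent_chart A c)"
    and "snd (tangent_chart A c) u = snd (tangent_chart A c) u'"
  then have eq: "snd c (fst u) = snd c (fst u')" "snd u c = snd u' c"
    by (simp_all add: snd_tangent_chart)
  then have p: "fst u = fst u'"
    using chart_inj[OF c] u by (auto simp: inj_on_def fst_tangent_chart)
  moreover have "snd u = snd u'"
    by (rule tangent_space_eqI[OF c, of "fst u"]) (use u p eq in \<open>simp_all add: fst_tangent_chart\<close>)
  ultimately show "u = u'" by (rule prod_eqI)
qed

lemma chart_inv_tangent_chart [simp]:
  "c \<in> A \<Longrightarrow> u \<in> fst (tangent_chart A c) \<Longrightarrow> chart_inv (tangent_chart A c) (snd (tangent_chart A c) u) = u"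
  by (simp add: chart_inv_def inj_on_tangent_chart)

lemma tangent_chart_overlap:
  assumes "c \<in> A" "d \<in> A"
  shows "snd (tangent_chart A c) ` (fst (tangent_chart A c) \<inter> fst (tangent_chart A d)) =
    (snd c ` (fst c \<inter> fst d)) \<times> UNIV"
proof -
  have "fst (tangent_chart A c) \<inter> fst (tangent_chart A d) =
      {u. fst u \<in> fst c \<inter> fst d \<and> snd u \<in> tangent_space A (fst u)}"
    by (auto simp: fst_tangent_chart)
  then show ?thesis
    using image_tangent_chart[OF assms(1), of "fst c \<inter> fst d"] by simp
qed

text \<open>The coordinate change of the tangent bundle is the prolongation of the one on the base.
  It is linear in the fibre variable, whence its smoothness follows from that of the base
  derivatives in fixed directions.\<close>

lemma tangent_transition:
  assumes "c \<in> A" "d \<in> A" "fst z \<in> snd c ` (fst c \<inter> fst d)"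
  shows "transition (tangent_chart A c) (tangent_chart A d) z =
    (transition c d (fst z), frechet_derivative (transition c d) (at (fst z)) (snd z))"
proof -
  have "z \<in> snd (tangent_chart A c) ` (fst (tangent_chart A c) \<inter> fst (tangent_chart A d))"
    using assms by (simp add: tangent_chart_overlap mem_Times_iff)
  then obtain u where u: "u \<in> fst (tangent_chart A c)" "u \<in> fst (tangent_chart A d)"
    "z = snd (tangent_chart A c) u" by auto
  have "transition (tangent_chart A c) (tangent_chart A d) z = (snd d (fst u), snd u d)"
    using u assms by (simp add: snd_tangent_chart[of d])
  moreover have "fst u \<in> fst c" "fst u \<in> fst d" "snd u \<in> tangent_space A (fst u)"
    using u by (auto simp: fst_tangent_chart)
  ultimately show ?thesis
    using assms u(3) tangent_space_component[of c d "fst u" "snd u"]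
    by (simp add: snd_tangent_chart)
qed

lemma smooth_tangent_transition:
  assumes "c \<in> A" "d \<in> A"
  shows "smooth_on ((snd c ` (fst c \<inter> fst d)) \<times> UNIV)
    (transition (tangent_chart A c) (tangent_chart A d))"
proof (rule smooth_on_cong)
  let ?S = "snd c ` (fst c \<inter> fst d)"
  show S2: "open (?S \<times> (UNIV :: 'e set))"
    using open_overlap[OF assms] by (simp add: open_Times)
  have comp: "smooth_on (?S \<times> (UNIV :: 'e set)) (\<lambda>z. g (fst z))" if "smooth_on ?S g" for g :: "'e \<Rightarrow> 'e"
    by (rule smooth_on_compose[OF S2 open_overlap[OF assms] _ _ that])
       (auto intro!: smooth_on_fst smooth_on_ident S2)
  show "smooth_on (?S \<times> UNIV) (\<lambda>z. (transition c d (fst z),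
      \<Sum>b\<in>Basis. (snd z \<bullet> b) *\<^sub>R frechet_derivative (transition c d) (at (fst z)) b))"
    by (intro smooth_on_Pair smooth_on_sum smooth_on_scaleR smooth_on_inner_left smooth_on_snd
        smooth_on_ident comp smooth_on_derivative smooth_transition assms S2)
  fix z assume z: "z \<in> ?S \<times> (UNIV :: 'e set)"
  then have fz: "fst z \<in> ?S" by auto
  then obtain p where "p \<in> fst c" "p \<in> fst d" "fst z = snd c p" by auto
  then have "linear (frechet_derivative (transition c d) (at (fst z)))"
    using linear_transition_derivative[OF assms, of p] by simp
  from linear_euclidean_expansion[OF this, of "snd z"] show
    "(transition c d (fst z), \<Sum>b\<in>Basis. (snd z \<bullet> b) *\<^sub>R frechet_derivative (transition c d) (at (fst z)) b) =
      transition (tangent_chart A c) (tangent_chart A d) z"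
    using tangent_transition[OF assms fz] by simp
qed

lemma smooth_atlas_tangent_atlas: "smooth_atlas (tangent_atlas A)"
  unfolding smooth_atlas_def tangent_atlas_def ball_simps
proof (intro conjI ballI)
  fix c assume c: "c \<in> A"
  show "inj_on (snd (tangent_chart A c)) (fst (tangent_chart A c))"
    using inj_on_tangent_chart[OF c] .
  show "open (snd (tangent_chart A c) ` fst (tangent_chart A c))"
    using tangent_chart_overlap[OF c c] open_chart_image[OF c] by (simp add: open_Times)
  fix d assume d: "d \<in> A"
  show "open (snd (tangent_chart A c) ` (fst (tangent_chart A c) \<inter> fst (tangent_chart A d)))"
    using tangent_chart_overlap[OF c d] open_overlap[OF c d] by (simp add: open_Times)
  show "smooth_on (snd (tangent_chart A c) ` (fst (tangent_chart A c) \<inter> fst (tangent_chart A d)))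
      (transition (tangent_chart A c) (tangent_chart A d))"
    unfolding tangent_chart_overlap[OF c d] by (rule smooth_tangent_transition[OF c d])
qed

text \<open>The Jacobian of the induced coordinate change is block triangular, because the new base
  coordinates depend on the old base coordinates alone. Hence the x-part of a vector tangent to the
  tangent bundle transforms like a vector on the base.\<close>

lemma fst_tangent_chart_component:
  assumes b: "b \<in> A" "u \<in> fst (tangent_chart A b)" and d: "d \<in> A" "u \<in> fst (tangent_chart A d)"
    and w: "w \<in> tangent_space (tangent_atlas A) u"
  shows "fst (w (tangent_chart A d)) =
    transition_derivative b d (fst u) (fst (w (tangent_chart A b)))"
proof -
  let ?b = "tangent_chart A b" and ?d = "tangent_chart A d"
  let ?z = "snd ?b u" and ?S = "(snd b ` (fst b \<inter> fst d)) \<times> (UNIV :: 'e set)"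
  have ub: "fst u \<in> fst b" and ud: "fst u \<in> fst d"
    using b d by (auto simp: fst_tangent_chart)
  have mem: "?b \<in> tangent_atlas A" "?d \<in> tangent_atlas A"
    using b d by (auto simp: tangent_atlas_def)
  have S: "open ?S" using open_overlap[OF b(1) d(1)] by (simp add: open_Times)
  have z: "?z \<in> ?S" using ub ud by (auto simp: snd_tangent_chart)
  have fz: "fst ?z = snd b (fst u)" by (simp add: snd_tangent_chart)
  have "(transition ?b ?d has_derivative transition_derivative ?b ?d u) (at ?z)"
    by (rule smooth_on_has_derivative[OF smooth_tangent_transition[OF b(1) d(1)] z])
  from bounded_linear.has_derivative[OF bounded_linear_fst this]
  have 1: "((\<lambda>z. fst (transition ?b ?d z)) has_derivative (\<lambda>v. fst (transition_derivative ?b ?d u v))) (at ?z)" .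
  have "((transition b d \<circ> fst) has_derivative (transition_derivative b d (fst u) \<circ> fst)) (at ?z)"
  proof (rule diff_chain_at)
    show "(fst has_derivative fst) (at ?z)"
      by (intro bounded_linear_imp_has_derivative bounded_linear_fst)
    show "(transition b d has_derivative transition_derivative b d (fst u)) (at (fst ?z))"
      unfolding fz by (rule transition_has_derivative[OF b(1) d(1) ub ud])
  qed
  then have "((\<lambda>z. fst (transition ?b ?d z)) has_derivative
      (transition_derivative b d (fst u) \<circ> fst)) (at ?z)"
    by (rule has_derivative_transform_within_open[OF _ S z])
       (use tangent_transition[OF b(1) d(1)] in auto)
  from has_derivative_unique[OF 1 this]
  have "fst (transition_derivative ?b ?d u (w ?b)) = transition_derivative b d (fst u) (fst (w ?b))"
    by (metis comp_apply)
  moreover have "w ?d = transition_derivative ?b ?d u (w ?b)"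
    using w mem b(2) d(2) unfolding tangent_space_def by blast
  ultimately show ?thesis by simp
qed

text \<open>The differential of the bundle projection is, in induced coordinates, the projection to
  the x-part. The definition computes it in an arbitrarily chosen chart; the block triangular
  transformation law then carries the vanishing of the x-part from that chart to \<open>c\<close>
  and back.\<close>

lemma vertical_iff:
  assumes c: "c \<in> A" and u: "u \<in> fst (tangent_chart A c)"
    and w: "w \<in> tangent_space (tangent_atlas A) u"
  shows "w \<in> vertical A u \<longleftrightarrow> fst (w (tangent_chart A c)) = 0"
proof -
  \<comment> \<open>The chart in which \<open>deriv_along\<close> evaluates the derivative at
    \<open>u\<close>; all that is known of it is that it belongs to the atlas and contains
    \<open>u\<close>.\<close>
  define c' where "c' = (SOME c'. c' \<in> tangent_atlas A \<and> u \<in> fst c')"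
  have "c' \<in> tangent_atlas A \<and> u \<in> fst c'"
    unfolding c'_def by (rule someI[of _ "tangent_chart A c"]) (use c u in \<open>auto simp: tangent_atlas_def\<close>)
  then obtain e where e: "e \<in> A" "c' = tangent_chart A e" "u \<in> fst (tangent_chart A e)"
    by (auto simp: tangent_atlas_def)
  have ue: "fst u \<in> fst e" and uc: "fst u \<in> fst c"
    using e u by (auto simp: fst_tangent_chart)
  have along: "deriv_along (tangent_atlas A) u w (snd d \<circ> fst) =
      transition_derivative e d (fst u) (fst (w (tangent_chart A e)))"
    if d: "d \<in> A" "fst u \<in> fst d" for d
  proof -
    let ?S = "(snd e ` (fst e \<inter> fst d)) \<times> (UNIV :: 'e set)"
    let ?z = "snd (tangent_chart A e) u"
    have S: "open ?S" using open_overlap[OF e(1) d(1)] by (simp add: open_Times)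
    have z: "?z \<in> ?S" using ue d by (auto simp: snd_tangent_chart)
    have fz: "fst ?z = snd e (fst u)" by (simp add: snd_tangent_chart)
    have eq: "(transition e d \<circ> fst) z = ((snd d \<circ> fst) \<circ> chart_inv (tangent_chart A e)) z"
      if "z \<in> ?S" for z
      using that tangent_transition[OF e(1) d(1), of z] by (auto simp: snd_tangent_chart)
    have "((transition e d \<circ> fst) has_derivative (transition_derivative e d (fst u) \<circ> fst)) (at ?z)"
    proof (rule diff_chain_at)
      show "(fst has_derivative fst) (at ?z)"
        by (intro bounded_linear_imp_has_derivative bounded_linear_fst)
      show "(transition e d has_derivative transition_derivative e d (fst u)) (at (fst ?z))"
        unfolding fz by (rule transition_has_derivative[OF e(1) d(1) ue d(2)])
    qed
    from has_derivative_transform_within_open[OF this S z eq]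
    have "frechet_derivative ((snd d \<circ> fst) \<circ> chart_inv (tangent_chart A e)) (at ?z) =
        transition_derivative e d (fst u) \<circ> fst"
      using frechet_derivative_at by metis
    then show ?thesis
      by (simp add: deriv_along_def flip: c'_def e(2))
  qed
  have "pushforward (tangent_atlas A) A fst u w = coord_vec A e (fst u) (fst (w (tangent_chart A e)))"
    unfolding pushforward_def coord_vec_def using along by (intro ext) simp
  moreover have "coord_vec A e (fst u) v = 0 \<longleftrightarrow> v = 0" for v
    using coord_vec_self[OF e(1) ue, of v] linear_0[OF linear_coord_vec[OF e(1) ue]]
    by (metis zero_fun_apply)
  ultimately have 1: "w \<in> vertical A u \<longleftrightarrow> fst (w (tangent_chart A e)) = 0"
    using w by (simp add: vertical_def)
  show ?thesis
    unfolding 1 using fst_tangent_chart_component[OF c u e(1,3) w]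
      fst_tangent_chart_component[OF e(1,3) c u w]
      linear_0[OF linear_transition_derivative[OF c e(1) uc ue]]
      linear_0[OF linear_transition_derivative[OF e(1) c ue uc]] by metis
qed

end

section \<open>Adapted frames\<close>

text \<open>A function \<open>f\<close> that recovers the coefficients, linear or not, already
  forces \<open>b\<close> to be injective with independent range, as \<open>representation\<close>
  requires. It will be instantiated with the explicit formula \<open>frame_coeff\<close>.\<close>

lemma representation_range:
  fixes b :: "'k::finite \<Rightarrow> 'v::real_vector" and f :: "'v \<Rightarrow> 'k \<Rightarrow> real"
  assumes f: "\<And>a. f (\<Sum>k\<in>UNIV. a k *\<^sub>R b k) = a"
  shows "representation (range b) (\<Sum>k\<in>UNIV. a k *\<^sub>R b k) (b l) = a l"
proof -
  have fb: "f (b k) = (\<lambda>l. if l = k then 1 else 0)" for k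
    using f[of "\<lambda>l. if l = k then 1 else 0"] by (simp add: if_distrib[of "\<lambda>r. r *\<^sub>R _"] cong: if_cong)
  have inj: "inj b"
    by (rule injI) (metis fb zero_neq_one)
  have sum_range: "(\<Sum>x\<in>range b. g x *\<^sub>R x) = (\<Sum>k\<in>UNIV. g (b k) *\<^sub>R b k)" for g :: "'v \<Rightarrow> real"
    using inj by (simp add: sum.reindex)
  have ind: "independent (range b)"
  proof (rule independent_if_scalars_zero)
    fix g :: "'v \<Rightarrow> real" and x
    assume "(\<Sum>x\<in>range b. g x *\<^sub>R x) = 0" "x \<in> range b"
    then have "f (\<Sum>k\<in>UNIV. g (b k) *\<^sub>R b k) = f (\<Sum>k\<in>UNIV. 0 *\<^sub>R b k)"
      by (simp add: sum_range)
    then have "(\<lambda>k. g (b k)) = (\<lambda>k. 0)"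
      unfolding f .
    then show "g x = 0"
      using \<open>x \<in> range b\<close> by (auto dest: fun_cong)
  qed simp
  have "representation (range b) (\<Sum>k\<in>UNIV. a k *\<^sub>R b k) =
      (\<lambda>x. if x \<in> range b then a (inv b x) else 0)" (is "_ = ?g")
  proof (rule representation_eqI[OF ind])
    show "(\<Sum>k\<in>UNIV. a k *\<^sub>R b k) \<in> span (range b)"
      by (intro span_sum span_scale span_base) auto
    have "{x. ?g x \<noteq> 0} \<subseteq> range b" by auto
    then show fin: "finite {x. ?g x \<noteq> 0}"
      by (rule finite_subset) simp
    have "(\<Sum>x | ?g x \<noteq> 0. ?g x *\<^sub>R x) = (\<Sum>x\<in>range b. ?g x *\<^sub>R x)"
      by (rule sum.mono_neutral_left) auto
    then show "(\<Sum>x | ?g x \<noteq> 0. ?g x *\<^sub>R x) = (\<Sum>k\<in>UNIV. a k *\<^sub>R b k)"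
      unfolding sum_range by (simp add: inj)
  qed (auto split: if_splits)
  then show ?thesis
    by (simp add: inj)
qed

lemma sum_axis: "(\<Sum>j\<in>UNIV. a j *\<^sub>R axis j (1::real)) = (\<chi> j. a j)"
  by (simp add: vec_eq_iff axis_def if_distrib[of "\<lambda>r. _ * r"] cong: if_cong)

lemma sum_fun_apply: "(\<Sum>i\<in>I. f i) x = (\<Sum>i\<in>I. f i x)"
  by (induction I rule: infinite_finite_induct) auto

lemma proj_along_eq:
  assumes "subspace S" "subspace T" "S \<inter> T = {0}" "a \<in> S" "b \<in> T"
  shows "proj_along S T (a + b) = a"
  unfolding proj_along_def
proof (rule the_equality)
  fix a' assume a': "a' \<in> S \<and> a + b - a' \<in> T"
  then have "a - a' \<in> S" "a - a' \<in> T"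
    using assms subspace_diff[of S a a'] subspace_diff[of T "a + b - a'" b] by auto
  then have "a - a' \<in> {0}" using assms(3) by blast
  then show "a' = a" by simp
qed (use assms in simp)

text \<open>Adapted frames make sense for every index type \<open>'i\<close>; the splitting of the
  index into two halves is introduced with the hypercomplex structure.\<close>

locale adapted_chart =
  fixes A :: "('p, real^'i) chart set" and M' W :: "('p, real^'i) tpoint set"
    and H :: "('p, real^'i) tpoint \<Rightarrow> (('p, real^'i) tpoint, (real^'i) \<times> (real^'i)) tvec set"
    and c :: "('p, real^'i) chart"
  assumes A: "smooth_atlas A" and H: "nonlinear_connection A M' H" and c: "c \<in> A"
    and openW: "openin (manifold_topology (tangent_atlas A)) W"
    and W: "W \<subseteq> M' \<inter> fst (tangent_chart A c)"
begin

section \<open>Coordinate fields and the horizontal-vertical splitting\<close>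

abbreviation "B \<equiv> tangent_atlas A"
abbreviation "tc \<equiv> tangent_chart A c"

lemma B: "smooth_atlas B"
  by (rule smooth_atlas_tangent_atlas[OF A])

lemma tc: "tc \<in> B"
  using c by (auto simp: tangent_atlas_def)

lemma W_tc: "u \<in> W \<Longrightarrow> u \<in> fst tc"
  using W by auto

lemma subspace_H: "u \<in> W \<Longrightarrow> subspace (H u)"
  and H_tangent: "u \<in> W \<Longrightarrow> H u \<subseteq> tangent_space B u"
  and H_vertical: "u \<in> W \<Longrightarrow> H u \<inter> vertical A u = {0}"
  using H W by (auto simp: nonlinear_connection_def smooth_distribution_def)

lemma H_plus_vertical:
  assumes "u \<in> W" "w \<in> tangent_space B u"
  obtains a b where "a \<in> H u" "b \<in> vertical A u" "w = a + b"
proof -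
  have "u \<in> M'" using W assms(1) by auto
  then have "{a + b | a b. a \<in> H u \<and> b \<in> vertical A u} = tangent_space B u"
    using H by (simp add: nonlinear_connection_def)
  then have "w \<in> {a + b | a b. a \<in> H u \<and> b \<in> vertical A u}"
    using assms(2) by simp
  then show ?thesis by (auto intro: that)
qed

lemma vertical_iff_tc:
  "u \<in> W \<Longrightarrow> w \<in> vertical A u \<longleftrightarrow> w \<in> tangent_space B u \<and> fst (w tc) = 0"
  using vertical_iff[OF A c W_tc, of u w] by (cases "w \<in> tangent_space B u") (simp_all add: vertical_def)

lemma subspace_vertical: "u \<in> W \<Longrightarrow> subspace (vertical A u)"
  using subspace_tangent_space[OF B, of u]
  by (auto simp: subspace_def vertical_iff_tc scaleR_fun_def)

lemma ddx_tangent: "u \<in> W \<Longrightarrow> ddx A c u i \<in> tangent_space B u"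
  and ddy_tangent: "u \<in> W \<Longrightarrow> ddy A c u i \<in> tangent_space B u"
  by (auto simp: ddx_def ddy_def intro!: coord_vec_in_tangent_space[OF B tc] W_tc)

lemma ddx_component: "u \<in> W \<Longrightarrow> ddx A c u i tc = (axis i 1, 0)"
  and ddy_component: "u \<in> W \<Longrightarrow> ddy A c u i tc = (0, axis i 1)"
  by (auto simp: ddx_def ddy_def coord_vec_self[OF B tc] W_tc)

lemma sum_ddy_component:
  "u \<in> W \<Longrightarrow> (\<Sum>j\<in>UNIV. a j *\<^sub>R ddy A c u j) tc = (0, \<chi> j. a j)"
  by (simp add: sum_fun_apply scaleR_fun_def ddy_component scaleR_prod_def sum_prod sum_axis)

lemma sum_ddy_vertical: "u \<in> W \<Longrightarrow> (\<Sum>j\<in>UNIV. a j *\<^sub>R ddy A c u j) \<in> vertical A u"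
  by (simp add: vertical_iff_tc sum_ddy_component)
     (intro subspace_sum subspace_scale subspace_tangent_space[OF B] ddy_tangent)

lemma vertical_eq_sum_ddy:
  assumes "u \<in> W" "w \<in> vertical A u"
  shows "w = (\<Sum>j\<in>UNIV. (snd (w tc) $ j) *\<^sub>R ddy A c u j)"
  by (rule tangent_space_eqI[OF B tc, of u])
     (use assms sum_ddy_vertical[OF assms(1)] in
        \<open>auto simp: W_tc vertical_iff_tc sum_ddy_component prod_eq_iff\<close>)

text \<open>Discharges the definite description in \<open>conn_coeff\<close>. Existence: subtracting
  from each coordinate vector its vertical part leaves a vector of H. Uniqueness: two solutions
  differ by vertical vectors lying in H, which vanish.\<close>

lemma ex1_conn_coeff:
  assumes u: "u \<in> W"
  shows "\<exists>!N. \<forall>i. ddx A c u i - (\<Sum>j\<in>UNIV. N i j *\<^sub>R ddy A c u j) \<in> H u"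
proof -
  have "\<exists>n. ddx A c u i - (\<Sum>j\<in>UNIV. n j *\<^sub>R ddy A c u j) \<in> H u" for i
  proof -
    obtain a b where a: "a \<in> H u" and b: "b \<in> vertical A u" and ab: "ddx A c u i = a + b"
      using H_plus_vertical[OF u ddx_tangent[OF u]] .
    have "ddx A c u i - (\<Sum>j\<in>UNIV. snd (b tc) $ j *\<^sub>R ddy A c u j) = a"
      unfolding vertical_eq_sum_ddy[OF u b, symmetric] ab by simp
    then show ?thesis
      using a by (intro exI[of _ "\<lambda>j. snd (b tc) $ j"]) simp
  qed
  then have "\<forall>i. \<exists>n. ddx A c u i - (\<Sum>j\<in>UNIV. n j *\<^sub>R ddy A c u j) \<in> H u" ..
  from choice[OF this] obtain N
    where N: "\<forall>i. ddx A c u i - (\<Sum>j\<in>UNIV. N i j *\<^sub>R ddy A c u j) \<in> H u" ..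
  show ?thesis
  proof (rule ex1I[of _ N], rule N, intro ext)
    fix N' i j
    assume N': "\<forall>i. ddx A c u i - (\<Sum>j\<in>UNIV. N' i j *\<^sub>R ddy A c u j) \<in> H u"
    have "(ddx A c u i - (\<Sum>j\<in>UNIV. N i j *\<^sub>R ddy A c u j)) -
        (ddx A c u i - (\<Sum>j\<in>UNIV. N' i j *\<^sub>R ddy A c u j)) \<in> H u"
      by (rule subspace_diff[OF subspace_H[OF u] N[rule_format] N'[rule_format]])
    also have "(ddx A c u i - (\<Sum>j\<in>UNIV. N i j *\<^sub>R ddy A c u j)) -
        (ddx A c u i - (\<Sum>j\<in>UNIV. N' i j *\<^sub>R ddy A c u j)) =
        (\<Sum>j\<in>UNIV. (N' i j - N i j) *\<^sub>R ddy A c u j)"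
      by (simp add: scaleR_left_diff_distrib sum_subtractf)
    finally have "(\<Sum>j\<in>UNIV. (N' i j - N i j) *\<^sub>R ddy A c u j) = 0"
      using sum_ddy_vertical[OF u, of "\<lambda>j. N' i j - N i j"] H_vertical[OF u] by blast
    then have "(0, \<chi> j. N' i j - N i j) = (0 :: (real^'i) \<times> (real^'i))"
      using sum_ddy_component[OF u, of "\<lambda>j. N' i j - N i j"] by simp
    then show "N' i j = N i j"
      by (simp add: vec_eq_iff zero_prod_def)
  qed
qed

lemma delta_in_H: "u \<in> W \<Longrightarrow> delta A H c u i \<in> H u"
  using theI'[OF ex1_conn_coeff] by (simp add: delta_def conn_coeff_def)

lemma delta_component:
  "u \<in> W \<Longrightarrow> delta A H c u i tc = (axis i 1, - (\<chi> j. conn_coeff A H c u i j))"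
  by (simp add: delta_def ddx_component sum_ddy_component)

definition comb where "comb u a = (\<Sum>k\<in>UNIV. a k *\<^sub>R adapted_frame A H c u k)"

text \<open>In the chart, \<open>\<delta>\<^sub>i\<close> and \<open>\<partial>\<^sub>j\<close> have the components \<open>(e\<^sub>i, - N\<^sub>i)\<close> and \<open>(0, e\<^sub>j)\<close>.\<close>

definition frame_coeff where "frame_coeff u w k = (case k of
    Inl i \<Rightarrow> fst (w tc) $ i
  | Inr j \<Rightarrow> snd (w tc) $ j + (\<Sum>i\<in>UNIV. fst (w tc) $ i * conn_coeff A H c u i j))"

lemma comb_split: "comb u a = (\<Sum>i\<in>UNIV. a (Inl i) *\<^sub>R delta A H c u i) + (\<Sum>j\<in>UNIV. a (Inr j) *\<^sub>R ddy A c u j)"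
  unfolding comb_def UNIV_Plus_UNIV[symmetric]
  by (subst sum.Plus) (auto simp: adapted_frame_def)

lemma sum_delta_in_H: "u \<in> W \<Longrightarrow> (\<Sum>i\<in>UNIV. a i *\<^sub>R delta A H c u i) \<in> H u"
  by (intro subspace_sum subspace_scale delta_in_H subspace_H)

lemma comb_tangent: "u \<in> W \<Longrightarrow> comb u a \<in> tangent_space B u"
  unfolding comb_split
  by (rule subspace_add[OF subspace_tangent_space[OF B] subsetD[OF H_tangent sum_delta_in_H]
        conjunct1[OF iffD1[OF vertical_iff_tc sum_ddy_vertical]]])

lemma comb_component:
  "u \<in> W \<Longrightarrow> comb u a tc =
     (\<chi> i. a (Inl i), \<chi> j. a (Inr j) - (\<Sum>i\<in>UNIV. a (Inl i) * conn_coeff A H c u i j))"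
  by (simp add: comb_split sum_ddy_component)
     (simp add: sum_fun_apply scaleR_fun_def delta_component scaleR_prod_def sum_prod sum_axis
        prod_eq_iff vec_eq_iff sum_negf)

text \<open>The correction by N in \<open>frame_coeff\<close> cancels the \<open>- N\<close> carried
  by the \<delta>_i. This is the recovery property that \<open>representation_range\<close> asks
  for, so \<open>frame_map\<close> can be evaluated on combinations of the frame.\<close>

lemma frame_coeff_comb: "u \<in> W \<Longrightarrow> frame_coeff u (comb u a) = a"
  by (auto simp: frame_coeff_def comb_component fun_eq_iff split: sum.splits)

lemma comb_frame_coeff: "u \<in> W \<Longrightarrow> w \<in> tangent_space B u \<Longrightarrow> comb u (frame_coeff u w) = w"
  by (rule tangent_space_eqI[OF B tc W_tc comb_tangent])
     (simp_all add: comb_component frame_coeff_def prod_eq_iff vec_eq_iff)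

lemma frame_coeff_add: "frame_coeff u (w + w') k = frame_coeff u w k + frame_coeff u w' k"
  and frame_coeff_diff: "frame_coeff u (w - w') k = frame_coeff u w k - frame_coeff u w' k"
  and frame_coeff_minus: "frame_coeff u (- w) k = - frame_coeff u w k"
  and frame_coeff_scaleR: "frame_coeff u (r *\<^sub>R w) k = r * frame_coeff u w k"
  and frame_coeff_zero: "frame_coeff u 0 k = 0"
  by (simp_all add: frame_coeff_def scaleR_fun_def distrib_left distrib_right left_diff_distrib sum.distrib
      sum_subtractf sum_negf sum_distrib_left mult.assoc split: sum.split)

lemma frame_coeff_eqI:
  "u \<in> W \<Longrightarrow> w \<in> tangent_space B u \<Longrightarrow> w' \<in> tangent_space B u \<Longrightarrow>
    (\<And>k. frame_coeff u w k = frame_coeff u w' k) \<Longrightarrow> w = w'"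
  using comb_frame_coeff[of u w] comb_frame_coeff[of u w'] by (simp add: comb_def)

lemma vertical_iff_frame_coeff:
  "u \<in> W \<Longrightarrow> w \<in> vertical A u \<longleftrightarrow> w \<in> tangent_space B u \<and> (\<forall>i. frame_coeff u w (Inl i) = 0)"
  by (auto simp: vertical_iff_tc frame_coeff_def vec_eq_iff)

lemma frame_map_comb:
  assumes "u \<in> W"
  shows "frame_map (adapted_frame A H c u) g (comb u a) = (\<Sum>k\<in>UNIV. a k *\<^sub>R g k)"
  unfolding frame_map_def comb_def
  by (subst representation_range[where f = "frame_coeff u"])
     (use frame_coeff_comb[OF assms] in \<open>simp_all add: comb_def\<close>)

lemma hproj_comb:
  assumes "u \<in> W"
  shows "hproj A H u (comb u a) = comb u (\<lambda>k. case k of Inl i \<Rightarrow> a (Inl i) | Inr j \<Rightarrow> 0)"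
  unfolding hproj_def comb_split
  using proj_along_eq[OF subspace_H subspace_vertical H_vertical sum_delta_in_H sum_ddy_vertical] assms
  by simp

lemma vproj_comb:
  assumes "u \<in> W"
  shows "vproj A H u (comb u a) = comb u (\<lambda>k. case k of Inl i \<Rightarrow> 0 | Inr j \<Rightarrow> a (Inr j))"
  unfolding vproj_def comb_split
  using proj_along_eq[OF subspace_vertical subspace_H _ sum_ddy_vertical sum_delta_in_H] H_vertical assms
  by (simp add: Int_commute add.commute)

end

context adapted_chart
begin

section \<open>Smoothness of the coefficients of the nonlinear connection\<close>

abbreviation "SW \<equiv> snd tc ` W"

lemma fst_tc_Int_W: "fst tc \<inter> W = W"
  using W by auto

lemma open_SW: "open SW"
  using open_image_openin[OF B openW tc] by (simp add: fst_tc_Int_W)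

lemma chart_inv_SW: "z \<in> SW \<Longrightarrow> chart_inv tc z \<in> W"
  using chart_inv_snd[OF B tc] W_tc by auto

text \<open>Removing the \<delta>-part of a horizontal vector leaves a vector both horizontal and
  vertical. Written out, the conclusion is a linear equation for the N_ij with the components of
  \<open>w\<close> as known data, the equation solved in the next lemma.\<close>

lemma frame_coeff_H:
  assumes u: "u \<in> W" and w: "w \<in> H u"
  shows "frame_coeff u w (Inr j) = 0"
proof -
  let ?d = "\<Sum>i\<in>UNIV. frame_coeff u w (Inl i) *\<^sub>R delta A H c u i"
  let ?v = "\<Sum>j\<in>UNIV. frame_coeff u w (Inr j) *\<^sub>R ddy A c u j"
  have "w \<in> tangent_space B u"
    using w H_tangent[OF u] by auto
  then have "w = ?d + ?v"
    using comb_frame_coeff[OF u] comb_split[of u "frame_coeff u w"] by simp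
  then have "?v = w - ?d"
    by (simp add: algebra_simps)
  then have "?v \<in> H u"
    using subspace_diff[OF subspace_H[OF u] w sum_delta_in_H[OF u, of "\<lambda>i. frame_coeff u w (Inl i)"]] by simp
  then have "?v = 0"
    using sum_ddy_vertical[OF u, of "\<lambda>j. frame_coeff u w (Inr j)"] H_vertical[OF u] by blast
  then have "(0, \<chi> j. frame_coeff u w (Inr j)) = (0 :: (real^'i) \<times> (real^'i))"
    using sum_ddy_component[OF u, of "\<lambda>j. frame_coeff u w (Inr j)"] by simp
  then show ?thesis
    by (simp add: vec_eq_iff zero_prod_def)
qed

lemma smooth_conn_coeff: "smooth_on SW (\<lambda>z. conn_coeff A H c (chart_inv tc z) i j)"
proof (rule smooth_on_local[OF open_SW])
  fix z assume "z \<in> SW"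
  then obtain u where u: "u \<in> W" "z = snd tc u" by auto
  then have "u \<in> M'" using W by auto
  moreover have "smooth_distribution B M' DIM(real^'i) H"
    using H by (simp add: nonlinear_connection_def)
  ultimately obtain U X where U: "openin (manifold_topology B) U" "u \<in> U"
    and X: "\<And>k. k < CARD('i) \<Longrightarrow> X k \<in> vector_fields B U"
    and frame: "\<And>q. q \<in> U \<Longrightarrow> inj_on (\<lambda>k. X k q) {..<CARD('i)} \<and>
        independent ((\<lambda>k. X k q) ` {..<CARD('i)}) \<and> span ((\<lambda>k. X k q) ` {..<CARD('i)}) = H q"
    unfolding smooth_distribution_def by force
  \<comment> \<open>The frame of the distribution is numbered by naturals, matrices by
    \<open>'i\<close>; \<open>e\<close> transports one index to the other.\<close>
  obtain e where "bij_betw e (UNIV :: 'i set) {0..<CARD('i)}"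
    using ex_bij_betw_finite_nat[of "UNIV :: 'i set"] by auto
  then have e: "inj e" "range e = {..<CARD('i)}"
    by (auto simp: bij_betw_def)
  have eX: "X (e l) \<in> vector_fields B U" for l
    using X e(2) by blast
  let ?T = "snd tc ` (fst tc \<inter> (U \<inter> W))"
  have T: "open ?T"
    using U openW by (intro open_image_openin[OF B _ tc] openin_Int)
  have inv_T: "chart_inv tc z \<in> U \<inter> W" if "z \<in> ?T" for z
    using that chart_inv_snd[OF B tc] by auto
  \<comment> \<open>For fixed \<open>j\<close> the unknowns are the N_lj. Each frame field gives one
    row: its x-part as coefficients, minus its y^j-component as right-hand side.\<close>
  define G where "G z = (\<chi> l k. fst (X (e l) (chart_inv tc z) tc) $ k)" for z
  define b where "b z = (\<chi> l. - (snd (X (e l) (chart_inv tc z) tc) $ j))" for z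
  have smX: "smooth_on ?T (\<lambda>z. X (e l) (chart_inv tc z) tc)" for l
  proof (rule smooth_on_subset)
    show "smooth_on (snd tc ` (fst tc \<inter> U)) (\<lambda>z. X (e l) (chart_inv tc z) tc)"
      using eX[of l] tc unfolding vector_fields_def by blast
  qed auto
  have "smooth_on ?T (\<lambda>z. (\<chi> l. conn_coeff A H c (chart_inv tc z) l j) $ i)"
  proof (rule smooth_on_solve[OF T])
    show "smooth_on ?T (\<lambda>z. G z $ l $ k)" for l k
      unfolding G_def by (simp add: smooth_on_vec_nth smooth_on_fst smX T)
    show "smooth_on ?T (\<lambda>z. b z $ l)" for l
      unfolding b_def by (simp add: smooth_on_minus smooth_on_vec_nth smooth_on_snd smX T)
  next
    fix z assume "z \<in> ?T"
    define q where "q = chart_inv tc z"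
    have q: "q \<in> U" "q \<in> W"
      using inv_T[OF \<open>z \<in> ?T\<close>] by (auto simp: q_def)
    define x where "x l = X (e l) q" for l
    have range_x: "range x = (\<lambda>k. X k q) ` {..<CARD('i)}"
      unfolding x_def e(2)[symmetric] by auto
    have inj_x: "inj x"
    proof (rule injI)
      fix l l' assume "x l = x l'"
      then have "e l = e l'"
        using frame[OF q(1)] e(2) unfolding x_def by (metis inj_on_eq_iff rangeI)
      then show "l = l'" using e(1) by (simp add: inj_eq)
    qed
    have xH: "x l \<in> H q" for l
      using frame[OF q(1)] span_base[of "x l" "range x"] by (simp add: range_x[symmetric])
    show "G z *v (\<chi> l. conn_coeff A H c (chart_inv tc z) l j) = b z"
      using frame_coeff_H[OF q(2) xH]
      by (simp add: vec_eq_iff matrix_vector_mult_def G_def b_def frame_coeff_def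
          eq_neg_iff_add_eq_0 add.commute flip: q_def x_def)
    \<comment> \<open>A vanishing combination of rows is a combination of frame vectors with zero
      x-part. Being vertical and in H it is zero, and independence of the frame kills its
      coefficients.\<close>
    have "\<forall>a. (\<Sum>l\<in>UNIV. a l *s row l (G z)) = 0 \<longrightarrow> (\<forall>l. a l = 0)"
    proof (intro allI impI)
      fix a l assume a: "(\<Sum>l\<in>UNIV. a l *s row l (G z)) = 0"
      let ?w = "\<Sum>l\<in>UNIV. a l *\<^sub>R x l"
      have wH: "?w \<in> H q"
        by (intro subspace_sum subspace_scale subspace_H[OF q(2)] xH)
      have "fst (?w tc) = (\<Sum>l\<in>UNIV. a l *s row l (G z))"
        by (simp add: sum_fun_apply scaleR_fun_def fst_sum row_def G_def vec_eq_iff flip: q_def x_def)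
      then have "?w \<in> vertical A q"
        using a wH H_tangent[OF q(2)] vertical_iff_tc[OF q(2), of ?w] by auto
      then have w0: "?w = 0"
        using wH H_vertical[OF q(2)] by blast
      have "a (inv x (x l)) = 0"
      proof (rule independentD[of "range x" "range x" "\<lambda>v. a (inv x v)"])
        show "independent (range x)"
          using frame[OF q(1)] by (simp add: range_x)
        show "(\<Sum>v\<in>range x. a (inv x v) *\<^sub>R v) = 0"
          using w0 by (simp add: sum.reindex[OF inj_x] inv_f_f[OF inj_x])
      qed auto
      then show "a l = 0" by (simp add: inv_f_f[OF inj_x])
    qed
    then show "det (G z) \<noteq> 0"
      by (simp add: matrix_right_invertible_independent_rows[symmetric]
          invertible_right_inverse[symmetric] invertible_det_nz[symmetric])
  qed
  then have "smooth_on ?T (\<lambda>z. conn_coeff A H c (chart_inv tc z) i j)"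
    by simp
  moreover have "z \<in> ?T"
    using u U W_tc by auto
  ultimately show "\<exists>T. open T \<and> z \<in> T \<and> smooth_on T (\<lambda>z. conn_coeff A H c (chart_inv tc z) i j)"
    using T by blast
qed

section \<open>Vector fields through their frame coefficients\<close>

abbreviation "VF \<equiv> vector_fields B W"

text \<open>Vector fields without smoothness: the quaternion identities are pointwise and are proved
  at this level. The value 0 outside \<open>W\<close> makes pointwise identities on \<open>W\<close>
  into equations of functions.\<close>

definition tangent_fields where
  "tangent_fields = {Y. (\<forall>u\<in>W. Y u \<in> tangent_space B u) \<and> (\<forall>u. u \<notin> W \<longrightarrow> Y u = 0)}"

text \<open>Chart components and frame coefficients determine each other by a triangular change with
  entries N, smooth in both directions by \<open>smooth_conn_coeff\<close>.\<close>

lemma vector_fields_iff_frame_coeff: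
  "Y \<in> VF \<longleftrightarrow> Y \<in> tangent_fields \<and>
     (\<forall>k. smooth_on SW (\<lambda>z. frame_coeff (chart_inv tc z) (Y (chart_inv tc z)) k))"
proof (intro iffI conjI allI)
  have W': "W \<subseteq> fst tc" using W by auto
  note VF_iff = vector_fields_iff_chart[OF B tc openW W']
  {
    assume "Y \<in> VF"
    then have Y: "Y \<in> tangent_fields" "smooth_on SW (\<lambda>z. Y (chart_inv tc z) tc)"
      by (auto simp: VF_iff tangent_fields_def)
    show "Y \<in> tangent_fields" by fact
    show "smooth_on SW (\<lambda>z. frame_coeff (chart_inv tc z) (Y (chart_inv tc z)) k)" for k
      by (cases k) (auto simp: frame_coeff_def intro!: smooth_on_add smooth_on_sum smooth_on_mult
          smooth_on_vec_nth smooth_on_fst smooth_on_snd smooth_conn_coeff Y open_SW)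
  }
  assume Y: "Y \<in> tangent_fields \<and>
     (\<forall>k. smooth_on SW (\<lambda>z. frame_coeff (chart_inv tc z) (Y (chart_inv tc z)) k))"
  define a where "a z = frame_coeff (chart_inv tc z) (Y (chart_inv tc z))" for z
  have sm: "smooth_on SW (\<lambda>z. a z k)" for k
    using Y by (simp add: a_def)
  have minus: "smooth_on SW (\<lambda>z. f z - g z)" if "smooth_on SW f" "smooth_on SW g"
    for f g :: "_ \<Rightarrow> real"
    using smooth_on_add[OF open_SW that(1) smooth_on_minus[OF open_SW that(2)]] by simp
  have "smooth_on SW (\<lambda>z. (\<Sum>i\<in>UNIV. a z (Inl i) *\<^sub>R axis i (1::real),
     \<Sum>j\<in>UNIV. (a z (Inr j) - (\<Sum>i\<in>UNIV. a z (Inl i) * conn_coeff A H c (chart_inv tc z) i j)) *\<^sub>R axis j (1::real)))"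
    by (intro smooth_on_Pair smooth_on_sum smooth_on_scaleR smooth_on_mult smooth_on_const
        minus sm smooth_conn_coeff open_SW)
  then have "smooth_on SW (\<lambda>z. Y (chart_inv tc z) tc)"
  proof (rule smooth_on_cong[OF open_SW, rotated])
    fix z assume "z \<in> SW"
    then have q: "chart_inv tc z \<in> W" by (rule chart_inv_SW)
    then have "Y (chart_inv tc z) = comb (chart_inv tc z) (a z)"
      using comb_frame_coeff[OF q, of "Y (chart_inv tc z)"] Y by (simp add: a_def tangent_fields_def)
    then show "(\<Sum>i\<in>UNIV. a z (Inl i) *\<^sub>R axis i (1::real),
     \<Sum>j\<in>UNIV. (a z (Inr j) - (\<Sum>i\<in>UNIV. a z (Inl i) * conn_coeff A H c (chart_inv tc z) i j)) *\<^sub>R axis j (1::real)) =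
      Y (chart_inv tc z) tc"
      by (simp add: comb_component[OF q] sum_axis)
  qed
  then show "Y \<in> VF"
    using Y by (simp add: VF_iff tangent_fields_def)
qed

lemma vector_fields_imp_tangent_fields: "Y \<in> VF \<Longrightarrow> Y \<in> tangent_fields"
  by (simp add: vector_fields_iff_frame_coeff)

lemma tangent_fields_eqI:
  assumes "Y \<in> tangent_fields" "Z \<in> tangent_fields"
    and "\<And>u k. u \<in> W \<Longrightarrow> frame_coeff u (Y u) k = frame_coeff u (Z u) k"
  shows "Y = Z"
proof
  fix u show "Y u = Z u"
  proof (cases "u \<in> W")
    case True
    then show ?thesis
      using assms by (intro frame_coeff_eqI[OF True]) (simp_all add: tangent_fields_def)
  next
    case False
    then have "Y u = 0" "Z u = 0"
      using assms(1,2) unfolding tangent_fields_def by blast+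
    then show ?thesis by simp
  qed
qed

lemma tangent_fields_add: "Y \<in> tangent_fields \<Longrightarrow> Z \<in> tangent_fields \<Longrightarrow> Y + Z \<in> tangent_fields"
  and tangent_fields_diff: "Y \<in> tangent_fields \<Longrightarrow> Z \<in> tangent_fields \<Longrightarrow> Y - Z \<in> tangent_fields"
  and tangent_fields_minus: "Y \<in> tangent_fields \<Longrightarrow> - Y \<in> tangent_fields"
  and tangent_fields_scale: "Y \<in> tangent_fields \<Longrightarrow> (\<lambda>u. f u *\<^sub>R Y u) \<in> tangent_fields"
  using subspace_tangent_space[OF B]
  by (simp_all add: tangent_fields_def subspace_add subspace_diff subspace_neg subspace_scale)

lemma vector_fields_add: "Y \<in> VF \<Longrightarrow> Z \<in> VF \<Longrightarrow> Y + Z \<in> VF"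
  and vector_fields_minus: "Y \<in> VF \<Longrightarrow> - Y \<in> VF"
  by (auto simp: vector_fields_iff_frame_coeff tangent_fields_add tangent_fields_minus
      frame_coeff_add frame_coeff_minus intro!: smooth_on_add smooth_on_minus open_SW)

lemma vector_fields_diff: "Y \<in> VF \<Longrightarrow> Z \<in> VF \<Longrightarrow> Y - Z \<in> VF"
  using vector_fields_add[of Y "- Z"] vector_fields_minus[of Z] by simp

lemma vector_fields_scale:
  assumes "smooth_fun B W f" "Y \<in> VF"
  shows "(\<lambda>u. f u *\<^sub>R Y u) \<in> VF"
proof -
  have "smooth_on SW (\<lambda>z. f (chart_inv tc z))"
    using assms(1) tc fst_tc_Int_W by (auto simp: smooth_fun_def o_def)
  then show ?thesis
    using assms(2) by (auto simp: vector_fields_iff_frame_coeff tangent_fields_scale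
      frame_coeff_scaleR intro!: smooth_on_mult open_SW)
qed

lemma vector_fields_scaleR: "Y \<in> VF \<Longrightarrow> r *\<^sub>R Y \<in> VF"
  using vector_fields_scale[of "\<lambda>u. r" Y] open_image_openin[OF B openW]
  by (simp add: smooth_fun_def o_def smooth_on_const scaleR_fun_def)

lemma bundle_sections_tangent_space: "bundle_sections B W (tangent_space B) = VF"
  by (auto simp: bundle_sections_def vector_fields_def)

lemma bundle_sections_vertical_iff:
  "Y \<in> bundle_sections B W (vertical A) \<longleftrightarrow> Y \<in> VF \<and> (\<forall>u\<in>W. \<forall>i. frame_coeff u (Y u) (Inl i) = 0)"
  by (auto simp: bundle_sections_def vertical_iff_frame_coeff vector_fields_iff_frame_coeff tangent_fields_def)

text \<open>All endomorphisms in the formula for \<open>D\<close> permute the adapted frame up to a factor in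
  \<open>{-1, 0, 1}\<close>, so that they preserve smoothness of coefficients.\<close>

definition monomial_map where
  "monomial_map s \<sigma> P \<longleftrightarrow> (\<forall>u\<in>W. \<forall>a. P u (comb u a) = comb u (\<lambda>k. s k * a (\<sigma> k)))"

lemma monomial_map_coeff:
  assumes P: "monomial_map s \<sigma> P" and Y: "Y \<in> tangent_fields" and u: "u \<in> W"
  shows "frame_coeff u (apply_on W P Y u) k = s k * frame_coeff u (Y u) (\<sigma> k)"
proof -
  have "P u (Y u) = P u (comb u (frame_coeff u (Y u)))"
    using comb_frame_coeff[OF u, of "Y u"] Y u by (simp add: tangent_fields_def)
  also have "\<dots> = comb u (\<lambda>k. s k * frame_coeff u (Y u) (\<sigma> k))"
    using P u by (simp add: monomial_map_def)
  finally show ?thesis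
    by (simp add: apply_on_def u frame_coeff_comb[OF u])
qed

lemma monomial_map_tangent_fields:
  assumes P: "monomial_map s \<sigma> P" and Y: "Y \<in> tangent_fields"
  shows "apply_on W P Y \<in> tangent_fields"
proof -
  have "P u (Y u) \<in> tangent_space B u" if u: "u \<in> W" for u
  proof -
    have "P u (Y u) = P u (comb u (frame_coeff u (Y u)))"
      using comb_frame_coeff[OF u, of "Y u"] Y u by (simp add: tangent_fields_def)
    also have "\<dots> = comb u (\<lambda>k. s k * frame_coeff u (Y u) (\<sigma> k))"
      using P u by (simp add: monomial_map_def)
    finally show ?thesis
      using comb_tangent[OF u] by simp
  qed
  then show ?thesis
    by (simp add: tangent_fields_def apply_on_def)
qed

lemma monomial_map_vector_fields:
  assumes P: "monomial_map s \<sigma> P" and Y: "Y \<in> VF"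
  shows "apply_on W P Y \<in> VF"
  unfolding vector_fields_iff_frame_coeff
proof (intro conjI allI)
  have Y': "Y \<in> tangent_fields"
    using Y by (rule vector_fields_imp_tangent_fields)
  show "apply_on W P Y \<in> tangent_fields"
    by (rule monomial_map_tangent_fields[OF P Y'])
  fix k
  have "smooth_on SW (\<lambda>z. s k * frame_coeff (chart_inv tc z) (Y (chart_inv tc z)) (\<sigma> k))"
    using Y by (intro smooth_on_mult smooth_on_const open_SW) (simp add: vector_fields_iff_frame_coeff)
  then show "smooth_on SW (\<lambda>z. frame_coeff (chart_inv tc z) (apply_on W P Y (chart_inv tc z)) k)"
    by (rule smooth_on_cong[OF open_SW, rotated])
       (simp only: monomial_map_coeff[OF P Y' chart_inv_SW])
qed

text \<open>Frame vectors are pushed along \<open>\<sigma>\<close> but coefficients are pulled back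
  along its inverse. For an involution the inverse is \<open>\<sigma>\<close> itself, and the factor
  at \<open>k\<close> is that of the source vector \<open>\<sigma> k\<close>.\<close>

lemma monomial_map_frame_map:
  assumes "\<And>u k. g u k = t k *\<^sub>R adapted_frame A H c u (\<sigma> k)" and inv: "\<And>k. \<sigma> (\<sigma> k) = k"
  shows "monomial_map (\<lambda>k. t (\<sigma> k)) \<sigma> (\<lambda>u. frame_map (adapted_frame A H c u) (g u))"
  unfolding monomial_map_def
proof (intro ballI allI)
  fix u a assume u: "u \<in> W"
  have "bij \<sigma>"
    by (rule o_bij[of \<sigma>]) (auto simp: inv)
  then have "(\<Sum>k\<in>UNIV. (t (\<sigma> k) * a (\<sigma> k)) *\<^sub>R adapted_frame A H c u k) =
     (\<Sum>k\<in>UNIV. (t (\<sigma> (\<sigma> k)) * a (\<sigma> (\<sigma> k))) *\<^sub>R adapted_frame A H c u (\<sigma> k))"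
    by (intro sum.reindex_bij_betw[symmetric]) (simp add: bij_betw_def bij_def)
  then show "frame_map (adapted_frame A H c u) (g u) (comb u a) = comb u (\<lambda>k. t (\<sigma> k) * a (\<sigma> k))"
    unfolding frame_map_comb[OF u] by (simp add: assms(1) comb_def inv mult.commute)
qed

lemma monomial_map_hproj: "monomial_map (case_sum (\<lambda>i. 1) (\<lambda>i. 0)) (\<lambda>k. k) (hproj A H)"
  unfolding monomial_map_def
  by (auto simp: hproj_comb intro!: arg_cong[where f = "comb _"] split: sum.split)

lemma monomial_map_vproj: "monomial_map (case_sum (\<lambda>i. 0) (\<lambda>i. 1)) (\<lambda>k. k) (vproj A H)"
  unfolding monomial_map_def
  by (auto simp: vproj_comb intro!: arg_cong[where f = "comb _"] split: sum.split)

end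

section \<open>The induced connection\<close>

text \<open>Additivity in the second argument gives this, through \<open>nab X 0 = 0\<close>. It
  moves the signs of quaternion products out of \<open>nab\<close>.\<close>

lemma linear_connection_minus:
  assumes nab: "linear_connection A W E nab" and X: "X \<in> vector_fields A W"
    and Y: "Y \<in> bundle_sections A W E" "- Y \<in> bundle_sections A W E" "0 \<in> bundle_sections A W E"
  shows "nab X (- Y) = - nab X Y"
proof -
  have add: "nab X (Z + Z') = nab X Z + nab X Z'"
    if "Z \<in> bundle_sections A W E" "Z' \<in> bundle_sections A W E" for Z Z'
    using nab X that by (simp add: linear_connection_def)
  have "nab X 0 = 0"
    using add[OF Y(3) Y(3)] by simp
  then show ?thesis
    using add[OF Y(1,2)] by (simp add: eq_neg_iff_add_eq_0 add.commute)
qed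

locale adapted_chart_connection = adapted_chart A M' W H c
  for A :: "('p, real^('n::finite + 'n)) chart set" and M' W :: "('p, 'n) tmpoint set"
    and H :: "('p, 'n) tmpoint \<Rightarrow> ('p, 'n) ttvec set"
    and c :: "('p, real^('n + 'n)) chart" +
  fixes nab :: "(('p, 'n) tmpoint \<Rightarrow> ('p, 'n) ttvec) \<Rightarrow> (('p, 'n) tmpoint \<Rightarrow> ('p, 'n) ttvec) \<Rightarrow>
      (('p, 'n) tmpoint \<Rightarrow> ('p, 'n) ttvec)"
  assumes nab: "linear_connection (tangent_atlas A) W (vertical A) nab"
begin

section \<open>The hypercomplex structure in the adapted frame\<close>

abbreviation "VS \<equiv> bundle_sections B W (vertical A)"

abbreviation "h \<equiv> apply_on W (hproj A H)"
abbreviation "v \<equiv> apply_on W (vproj A H)"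
abbreviation "j1 \<equiv> apply_on W (J1 A H c)"
abbreviation "j2 \<equiv> apply_on W (J2 A H c)"
abbreviation "j3 \<equiv> apply_on W (J3 A H c)"

text \<open>\<open>swap_outer\<close> exchanges \<delta>_i with \<partial>_i, and
  \<open>swap_inner\<close> exchanges the indices \<alpha> and n+\<alpha>. Up to sign J_1 acts by
  the first, J_2 by the second and J_3 by their product, so the permutations form a Klein four-group
  and the quaternion structure sits in the signs.\<close>

primrec swap_outer :: "('n + 'n) + ('n + 'n) \<Rightarrow> ('n + 'n) + ('n + 'n)" where
  "swap_outer (Inl i) = Inr i"
| "swap_outer (Inr i) = Inl i"

primrec swap_index :: "'n + 'n \<Rightarrow> 'n + 'n" where
  "swap_index (Inl \<alpha>) = Inr \<alpha>"
| "swap_index (Inr \<alpha>) = Inl \<alpha>"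

primrec swap_inner :: "('n + 'n) + ('n + 'n) \<Rightarrow> ('n + 'n) + ('n + 'n)" where
  "swap_inner (Inl i) = Inl (swap_index i)"
| "swap_inner (Inr i) = Inr (swap_index i)"

text \<open>The signs are indexed by the frame vector being mapped, not by its image, hence the
  swapped arguments in the coefficient formulas.\<close>

definition sign1 :: "('n + 'n) + ('n + 'n) \<Rightarrow> real"
  where "sign1 = case_sum (case_sum (\<lambda>_. 1) (\<lambda>_. - 1)) (case_sum (\<lambda>_. - 1) (\<lambda>_. 1))"

definition sign2 :: "('n + 'n) + ('n + 'n) \<Rightarrow> real"
  where "sign2 = case_sum (case_sum (\<lambda>_. 1) (\<lambda>_. - 1)) (case_sum (\<lambda>_. 1) (\<lambda>_. - 1))"

definition sign3 :: "('n + 'n) + ('n + 'n) \<Rightarrow> real"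
  where "sign3 = case_sum (\<lambda>_. - 1) (\<lambda>_. 1)"

lemma swap_index_twice: "swap_index (swap_index i) = i"
  by (cases i) auto

lemma swap_outer_twice: "swap_outer (swap_outer k) = k"
  and swap_inner_twice: "swap_inner (swap_inner k) = k"
  and swap_outer_inner: "swap_outer (swap_inner k) = swap_inner (swap_outer k)"
  by (cases k; simp add: swap_index_twice)+

lemma monomial_map_J1: "monomial_map (\<lambda>k. sign1 (swap_outer k)) swap_outer (J1 A H c)"
  unfolding J1_def
  by (rule monomial_map_frame_map)
     (auto simp: sign1_def adapted_frame_def swap_outer_twice split: sum.split)

lemma monomial_map_J2: "monomial_map (\<lambda>k. sign2 (swap_inner k)) swap_inner (J2 A H c)"
  unfolding J2_def
  by (rule monomial_map_frame_map)
     (auto simp: sign2_def adapted_frame_def swap_inner_twice split: sum.split)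

lemma monomial_map_J3:
  "monomial_map (\<lambda>k. sign3 (swap_outer (swap_inner k))) (\<lambda>k. swap_outer (swap_inner k)) (J3 A H c)"
  unfolding J3_def
  by (rule monomial_map_frame_map)
     (auto simp: sign3_def adapted_frame_def swap_outer_twice swap_inner_twice swap_outer_inner
       split: sum.split)

lemmas monomial_maps =
  monomial_map_hproj monomial_map_vproj monomial_map_J1 monomial_map_J2 monomial_map_J3

lemmas apply_tangent_fields = monomial_maps[THEN monomial_map_tangent_fields]
lemmas apply_vector_fields = monomial_maps[THEN monomial_map_vector_fields]
lemmas apply_coeff = monomial_maps[THEN monomial_map_coeff]

lemmas tangent_fields_intros = tangent_fields_add tangent_fields_diff tangent_fields_minus
  tangent_fields_scale apply_tangent_fields

lemma coeff_apply [simp]: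
  assumes "Y \<in> tangent_fields" "u \<in> W"
  shows "frame_coeff u (h Y u) (Inl i) = frame_coeff u (Y u) (Inl i)"
    and "frame_coeff u (h Y u) (Inr i) = 0"
    and "frame_coeff u (v Y u) (Inl i) = 0"
    and "frame_coeff u (v Y u) (Inr i) = frame_coeff u (Y u) (Inr i)"
    and "frame_coeff u (j1 Y u) (Inl (Inl \<alpha>)) = - frame_coeff u (Y u) (Inr (Inl \<alpha>))"
    and "frame_coeff u (j1 Y u) (Inl (Inr \<alpha>)) = frame_coeff u (Y u) (Inr (Inr \<alpha>))"
    and "frame_coeff u (j1 Y u) (Inr (Inl \<alpha>)) = frame_coeff u (Y u) (Inl (Inl \<alpha>))"
    and "frame_coeff u (j1 Y u) (Inr (Inr \<alpha>)) = - frame_coeff u (Y u) (Inl (Inr \<alpha>))"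
    and "frame_coeff u (j2 Y u) (Inl (Inl \<alpha>)) = - frame_coeff u (Y u) (Inl (Inr \<alpha>))"
    and "frame_coeff u (j2 Y u) (Inl (Inr \<alpha>)) = frame_coeff u (Y u) (Inl (Inl \<alpha>))"
    and "frame_coeff u (j2 Y u) (Inr (Inl \<alpha>)) = - frame_coeff u (Y u) (Inr (Inr \<alpha>))"
    and "frame_coeff u (j2 Y u) (Inr (Inr \<alpha>)) = frame_coeff u (Y u) (Inr (Inl \<alpha>))"
    and "frame_coeff u (j3 Y u) (Inl i) = frame_coeff u (Y u) (Inr (swap_index i))"
    and "frame_coeff u (j3 Y u) (Inr i) = - frame_coeff u (Y u) (Inl (swap_index i))"
  by (simp_all add: apply_coeff[OF assms] sign1_def sign2_def sign3_def)

text \<open>One case for each kind of frame vector, matching the index patterns of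
  \<open>coeff_apply\<close>, so that quaternion identities become arithmetic of signs.\<close>

lemma fields_eqI:
  assumes "Y \<in> tangent_fields" "Z \<in> tangent_fields"
    and "\<And>u \<alpha>. u \<in> W \<Longrightarrow> frame_coeff u (Y u) (Inl (Inl \<alpha>)) = frame_coeff u (Z u) (Inl (Inl \<alpha>))"
    and "\<And>u \<alpha>. u \<in> W \<Longrightarrow> frame_coeff u (Y u) (Inl (Inr \<alpha>)) = frame_coeff u (Z u) (Inl (Inr \<alpha>))"
    and "\<And>u \<alpha>. u \<in> W \<Longrightarrow> frame_coeff u (Y u) (Inr (Inl \<alpha>)) = frame_coeff u (Z u) (Inr (Inl \<alpha>))"
    and "\<And>u \<alpha>. u \<in> W \<Longrightarrow> frame_coeff u (Y u) (Inr (Inr \<alpha>)) = frame_coeff u (Z u) (Inr (Inr \<alpha>))"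
  shows "Y = Z"
proof (rule tangent_fields_eqI[OF assms(1,2)])
  fix u k assume "u \<in> W"
  then show "frame_coeff u (Y u) k = frame_coeff u (Z u) k"
    using assms(3-6)[of u] by (cases k rule: sum.exhaust[case_product sum.exhaust]; cases "projl k"; cases "projr k") auto
qed

lemma apply_linear:
  assumes "P \<in> {h, v, j1, j2, j3}"
  shows "Y \<in> tangent_fields \<Longrightarrow> Z \<in> tangent_fields \<Longrightarrow> P (Y + Z) = P Y + P Z"
    and "Y \<in> tangent_fields \<Longrightarrow> Z \<in> tangent_fields \<Longrightarrow> P (Y - Z) = P Y - P Z"
    and "Y \<in> tangent_fields \<Longrightarrow> P (- Y) = - P Y"
    and "Y \<in> tangent_fields \<Longrightarrow> P (\<lambda>u. f u *\<^sub>R Y u) = (\<lambda>u. f u *\<^sub>R P Y u)"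
  using assms
  by (auto intro!: fields_eqI tangent_fields_intros
      simp: frame_coeff_add frame_coeff_diff frame_coeff_minus frame_coeff_scaleR
        tangent_fields_intros)

lemma apply_scaleR:
  assumes "P \<in> {h, v, j1, j2, j3}" "Y \<in> tangent_fields"
  shows "P (r *\<^sub>R Y) = r *\<^sub>R P Y"
  using apply_linear(4)[OF assms, of "\<lambda>u. r"] by (simp add: scaleR_fun_def[of r])

text \<open>\<open>insertI1\<close> and \<open>insertI2\<close> select the members of the set one by
  one, which gives rewrite rules with a concrete head for each of the five operators.\<close>

lemmas apply_simps = apply_linear[OF insertI1] apply_linear[OF insertI2[OF insertI1]]
  apply_linear[OF insertI2[OF insertI2[OF insertI1]]]
  apply_linear[OF insertI2[OF insertI2[OF insertI2[OF insertI1]]]]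
  apply_linear[OF insertI2[OF insertI2[OF insertI2[OF insertI2[OF insertI1]]]]]
  apply_scaleR[OF insertI1] apply_scaleR[OF insertI2[OF insertI1]]
  apply_scaleR[OF insertI2[OF insertI2[OF insertI1]]]
  apply_scaleR[OF insertI2[OF insertI2[OF insertI2[OF insertI1]]]]
  apply_scaleR[OF insertI2[OF insertI2[OF insertI2[OF insertI2[OF insertI1]]]]]

text \<open>All nine products of two units are listed and the projections always move inwards, so
  that rewriting brings a word in the units to a single signed unit applied to a projected
  field.\<close>

lemma quaternion_relations:
  assumes "Y \<in> tangent_fields"
  shows "h Y + v Y = Y"
    and "v (j1 Y) = j1 (h Y)" "h (j1 Y) = j1 (v Y)"
    and "v (j2 Y) = j2 (v Y)" "h (j2 Y) = j2 (h Y)"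
    and "v (j3 Y) = j3 (h Y)" "h (j3 Y) = j3 (v Y)"
    and "j1 (j1 Y) = - Y" "j2 (j2 Y) = - Y" "j3 (j3 Y) = - Y"
    and "j1 (j2 Y) = j3 Y" "j2 (j3 Y) = j1 Y" "j3 (j1 Y) = j2 Y"
    and "j2 (j1 Y) = - j3 Y" "j3 (j2 Y) = - j1 Y" "j1 (j3 Y) = - j2 Y"
  using assms
  by (auto intro!: fields_eqI tangent_fields_intros
      simp: frame_coeff_add frame_coeff_minus tangent_fields_intros)

section \<open>Vertical sections and the rules for \<open>nab\<close>\<close>

lemma VS_imp_VF: "Y \<in> VS \<Longrightarrow> Y \<in> VF"
  by (simp add: bundle_sections_def)

lemma VF_imp_tangent: "Y \<in> VF \<Longrightarrow> Y \<in> tangent_fields"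
  by (rule vector_fields_imp_tangent_fields)

text \<open>These are the four arguments of \<open>nab\<close> in \<open>D\<close>: J_1 and J_3
  carry the horizontal part into the vertical bundle, J_2 keeps the vertical part there.\<close>

lemma VS_intros:
  assumes "Y \<in> VF"
  shows "v Y \<in> VS" "j1 (h Y) \<in> VS" "j2 (v Y) \<in> VS" "j3 (h Y) \<in> VS"
proof -
  have Y: "Y \<in> tangent_fields" using assms by (rule VF_imp_tangent)
  have "frame_coeff u (v Y u) (Inl i) = 0 \<and> frame_coeff u (j1 (h Y) u) (Inl i) = 0 \<and>
      frame_coeff u (j2 (v Y) u) (Inl i) = 0 \<and> frame_coeff u (j3 (h Y) u) (Inl i) = 0"
    if "u \<in> W" for u i
    using that Y by (cases i) (simp_all add: tangent_fields_intros)
  then show "v Y \<in> VS" "j1 (h Y) \<in> VS" "j2 (v Y) \<in> VS" "j3 (h Y) \<in> VS"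
    by (auto simp: bundle_sections_vertical_iff intro!: apply_vector_fields assms)
qed

lemma VS_minus: "Y \<in> VS \<Longrightarrow> - Y \<in> VS"
  by (auto simp: bundle_sections_vertical_iff frame_coeff_minus intro!: vector_fields_minus)

lemma VS_zero: "0 \<in> VS"
proof -
  have "(0 :: ('p, 'n) tmpoint \<Rightarrow> ('p, 'n) ttvec) \<in> VF"
    using open_SW subspace_0[OF subspace_tangent_space[OF B]]
    by (simp add: vector_fields_iff_frame_coeff tangent_fields_def frame_coeff_zero smooth_on_const)
  then show ?thesis
    by (simp add: bundle_sections_vertical_iff frame_coeff_zero)
qed

lemma nab_closed: "X \<in> VF \<Longrightarrow> Y \<in> VS \<Longrightarrow> nab X Y \<in> VS"
  using nab by (simp add: linear_connection_def)

lemma nab_tangent: "X \<in> VF \<Longrightarrow> Y \<in> VS \<Longrightarrow> nab X Y \<in> tangent_fields"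
  by (rule VF_imp_tangent[OF VS_imp_VF[OF nab_closed]])

lemma nab_add_left: "X \<in> VF \<Longrightarrow> X' \<in> VF \<Longrightarrow> Y \<in> VS \<Longrightarrow> nab (X + X') Y = nab X Y + nab X' Y"
  and nab_scale_left: "smooth_fun B W f \<Longrightarrow> X \<in> VF \<Longrightarrow> Y \<in> VS \<Longrightarrow>
    nab (\<lambda>u. f u *\<^sub>R X u) Y = (\<lambda>u. f u *\<^sub>R nab X Y u)"
  and nab_add_right: "X \<in> VF \<Longrightarrow> Y \<in> VS \<Longrightarrow> Y' \<in> VS \<Longrightarrow> nab X (Y + Y') = nab X Y + nab X Y'"
  and nab_Leibniz: "smooth_fun B W f \<Longrightarrow> X \<in> VF \<Longrightarrow> Y \<in> VS \<Longrightarrow>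
    nab X (\<lambda>u. f u *\<^sub>R Y u) = (\<lambda>u. deriv_along B u (X u) f *\<^sub>R Y u + f u *\<^sub>R nab X Y u)"
  using nab by (simp_all add: linear_connection_def)

lemma nab_minus: "X \<in> VF \<Longrightarrow> Y \<in> VS \<Longrightarrow> nab X (- Y) = - nab X Y"
  by (rule linear_connection_minus[OF nab _ _ VS_minus VS_zero])

section \<open>The connection axioms for \<open>D\<close> and the parallelism of the
  structure\<close>

abbreviation "D \<equiv> induced_D A H c W nab"

lemma D_eq: "D X Y = (1/2) *\<^sub>R (nab X (v Y) - j1 (nab X (j1 (h Y))) - j2 (nab X (j2 (v Y)))
    - j3 (nab X (j3 (h Y))))"
  by (simp add: induced_D_def Let_def)

lemma D_closed: "X \<in> VF \<Longrightarrow> Y \<in> VF \<Longrightarrow> D X Y \<in> VF"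
  unfolding D_eq
  by (intro vector_fields_scaleR vector_fields_diff apply_vector_fields VS_imp_VF[OF nab_closed]
      VS_intros)

lemma D_add_left:
  "X \<in> VF \<Longrightarrow> X' \<in> VF \<Longrightarrow> Y \<in> VF \<Longrightarrow> D (X + X') Y = D X Y + D X' Y"
  by (simp add: D_eq nab_add_left VS_intros apply_simps nab_tangent algebra_simps)

lemma D_add_right:
  "X \<in> VF \<Longrightarrow> Y \<in> VF \<Longrightarrow> Y' \<in> VF \<Longrightarrow> D X (Y + Y') = D X Y + D X Y'"
  by (simp add: D_eq nab_add_right VS_intros apply_simps nab_tangent VF_imp_tangent
      apply_tangent_fields algebra_simps)

lemma D_scale_left:
  "smooth_fun B W f \<Longrightarrow> X \<in> VF \<Longrightarrow> Y \<in> VF \<Longrightarrow> D (\<lambda>u. f u *\<^sub>R X u) Y = (\<lambda>u. f u *\<^sub>R D X Y u)"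
  by (simp add: D_eq nab_scale_left VS_intros apply_simps nab_tangent)
     (simp add: fun_eq_iff scaleR_fun_def algebra_simps)

lemma D_Leibniz:
  assumes f: "smooth_fun B W f" and X: "X \<in> VF" and Y: "Y \<in> VF"
  shows "D X (\<lambda>u. f u *\<^sub>R Y u) = (\<lambda>u. deriv_along B u (X u) f *\<^sub>R Y u + f u *\<^sub>R D X Y u)"
proof -
  have tY: "Y \<in> tangent_fields" using Y by (rule VF_imp_tangent)
  define d where "d u = deriv_along B u (X u) f" for u
  \<comment> \<open>Stated as a sum of two fields, each a function times a field, so that the
    linearity rules of the J_a apply to it.\<close>
  have Leibniz: "nab X (\<lambda>u. f u *\<^sub>R Z u) = (\<lambda>u. d u *\<^sub>R Z u) + (\<lambda>u. f u *\<^sub>R nab X Z u)" if "Z \<in> VS" for Z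
    using nab_Leibniz[OF f X that] by (simp add: d_def plus_fun_def)
  have hv1: "h Y u + v Y u = Y u" for u
    using fun_cong[OF quaternion_relations(1)[OF tY], of u] by simp
  have "v Y u + h Y u + v Y u + h Y u = (h Y u + v Y u) + (h Y u + v Y u)" for u
    by (simp only: ac_simps)
  then have hv: "v Y u + h Y u + v Y u + h Y u = 2 *\<^sub>R Y u" for u
    by (simp only: hv1 scaleR_2)
  have "D X (\<lambda>u. f u *\<^sub>R Y u) = (\<lambda>u. (1/2) *\<^sub>R
      (d u *\<^sub>R (v Y u + h Y u + v Y u + h Y u)) + f u *\<^sub>R D X Y u)"
    by (simp add: D_eq apply_simps tY apply_tangent_fields Leibniz VS_intros Y nab_tangent X
        tangent_fields_scale quaternion_relations)
       (simp add: fun_eq_iff scaleR_fun_def algebra_simps)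
  then show ?thesis
    by (simp add: hv d_def)
qed

lemma tangent_scaleR: "Y \<in> tangent_fields \<Longrightarrow> r *\<^sub>R Y \<in> tangent_fields"
  using tangent_fields_scale[of Y "\<lambda>u. r"] by (simp add: scaleR_fun_def)

text \<open>For J_1, the terms of \<open>D X (j1 Y)\<close> before halving become
  \<open>nab X (j1 (h Y))\<close>, \<open>j1 (nab X (v Y))\<close>,
  \<open>j2 (nab X (j3 (h Y)))\<close> and \<open>- j3 (nab X (j2 (v Y)))\<close>. These are J_1
  applied to the second, first, fourth and third terms of \<open>D X Y\<close>; the other two cases
  pair up likewise.\<close>

lemma D_parallel:
  assumes X: "X \<in> VF" and Y: "Y \<in> VF"
  shows "D X (j1 Y) = j1 (D X Y)" "D X (j2 Y) = j2 (D X Y)" "D X (j3 Y) = j3 (D X Y)"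
  using VF_imp_tangent[OF Y]
  by (simp_all add: D_eq apply_simps apply_tangent_fields quaternion_relations
      tangent_fields_diff tangent_scaleR nab_minus VS_intros nab_tangent X Y)

lemma linear_connection_D: "linear_connection B W (tangent_space B) D"
  unfolding linear_connection_def bundle_sections_tangent_space
  using D_closed D_add_left D_add_right D_scale_left D_Leibniz by blast

end

theorem theorem3p3:
  fixes A :: "('p, real^('n::finite + 'n)) chart set"
    and M' U' :: "('p, 'n) tmpoint set"
    and F :: "('p, 'n) tmpoint \<Rightarrow> real"
    and q :: nat
    and H :: "('p, 'n) tmpoint \<Rightarrow> ('p, 'n) ttvec set"
    and c :: "('p, real^('n + 'n)) chart"
    and nab :: "(('p, 'n) tmpoint \<Rightarrow> ('p, 'n) ttvec) \<Rightarrow> (('p, 'n) tmpoint \<Rightarrow> ('p, 'n) ttvec) \<Rightarrow>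
      (('p, 'n) tmpoint \<Rightarrow> ('p, 'n) ttvec)"
  assumes "pseudo_finsler_manifold A M' F q"
    and "nonlinear_connection A M' H"
    and "c \<in> A"
    and "openin (manifold_topology (tangent_atlas A)) U'"
    and "U' \<subseteq> M' \<inter> fst (tangent_chart A c)"
    and "linear_connection (tangent_atlas A) U' (vertical A) nab"
  shows "linear_connection (tangent_atlas A) U' (tangent_space (tangent_atlas A))
           (induced_D A H c U' nab) \<and>
         (\<forall>X\<in>vector_fields (tangent_atlas A) U'. \<forall>Y\<in>vector_fields (tangent_atlas A) U'.
            \<forall>J\<in>{J1 A H c, J2 A H c, J3 A H c}.
              induced_D A H c U' nab X (apply_on U' J Y) =
              apply_on U' J (induced_D A H c U' nab X Y))"
proof -
  interpret adapted_chart_connection A M' U' H c nab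
    by unfold_locales (use assms in \<open>auto simp: pseudo_finsler_manifold_def smooth_manifold_def\<close>)
  show ?thesis
    using linear_connection_D D_parallel by blast
qed

end
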